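(* Let $\kappa \in C^1(\mathbb R_+)$ be a function with $\kappa\big|_{\mathbb N_0} = (\kappa_n)_{n\ge 0}$. Then for all real $b>a>0$, all real $\beta \geq \alpha>0$, all $\zeta \in \mathbb R$ and all $z \in \mathsf R_\kappa(\zeta)$, the Kapteyn--Kummer series $$\mathscr K_\kappa(z)=\sum_{n \geq 0} \kappa_n\, M\big(a+\alpha n,\, b+\beta n,\, z(1+\zeta n)\big)$$ satisfies $$\begin{aligned} \mathscr K_\kappa(z) = {}& \kappa_0\, M(a, b, z) - \int_0^\infty \int_0^{[s]} \mathfrak d_u\Big( \frac{\kappa(u)\, \Gamma(b+\beta u)}{\Gamma(b-a+(\beta-\alpha)u)\,\Gamma(a+\alpha u)}\Big)\\ &\times \Big( \zeta z\, \boldsymbol\Gamma_1(s)\, M\big(a+\alpha s+1,\, b+\beta s+1,\, z(1+\zeta s)\big) + M^* \Big( \beta \frac{\partial}{\partial b} \boldsymbol\Gamma_0(s) + \alpha \frac{\partial}{\partial a} \boldsymbol\Gamma_0(s)\Big)\\ &\qquad + \boldsymbol\Gamma_0(s) \Big( \beta \frac{\partial M^*}{\partial b} + \alpha \frac{\partial M^*}{\partial a}\Big) \Big)\, {\rm d}u\,{\rm d}s , \end{aligned}$$ where the inner integral is over $u\in[0,[s]]$ and the outer one over $s\in(0,\infty)$, where $M^* := M\big(a+\alpha s,\, b+\beta s,\, z(1+\zeta s)\big)$ and, for $\rho\in\{0,1\}$, $$\boldsymbol\Gamma_\rho(s) = \frac{\Gamma(b-a+(\beta-\alpha)s)\,\Gamma(a+\alpha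 s+\rho)}{\Gamma(b+\beta s+\rho)}.$$ Moreover, $$\frac{\partial M^*}{\partial a} = \frac{z(1+\zeta s)}{b+\beta s}\; F_{2:0;1}^{1:1;2}\Big[ \begin{array}{c} a+\alpha s+1: 1;\ 1,\, a+\alpha s \\ 2,\, b+\beta s+1:-;\ a+\alpha s+1 \end{array} \Big| \begin{array}{c} z(1+\zeta s)\\ z(1+\zeta s) \end{array} \Big],$$ $$\frac{\partial M^*}{\partial b} = -\frac{(a+\alpha s)\,z(1+\zeta s)}{(b+\beta s)^2}\; F_{2:0;1}^{1:1;2}\Big[ \begin{array}{c} a+\alpha s+1: 1;\ 1,\, b+\beta s \\ 2,\, b+\beta s+1:-;\ b+\beta s+1\end{array} \Big| \begin{array}{c} z(1+\zeta s)\\ z(1+\zeta s) \end{array} \Big].$$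
   Context: $\mathbb R_+=[0,\infty)$, $\mathbb N_0=\{0,1,2,\dots\}$; $\kappa$ may be complex-valued, and $\kappa_n=\kappa(n)$. $[x]$ and $\{x\}=x-[x]$ are the integer and fractional parts of $x\in\mathbb R$. The operator $\mathfrak d_x = 1+\{x\}\frac{{\rm d}}{{\rm d}x}$ acts on $C^1$ functions by $\mathfrak d_x f(x)=f(x)+\{x\}f'(x)$. Kummer's function is $M(a,b,z)=\sum_{n\ge0}\frac{(a)_n}{(b)_n}\frac{z^n}{n!}$ for $a\in\mathbb C$, $b\in\mathbb C\setminus\{0,-1,-2,\dots\}$, $z\in\mathbb C$, where $(a)_n=a(a+1)\cdots(a+n-1)$, $(a)_0=1$, is the Pochhammer symbol. For real $\zeta$, $$\mathsf R_\kappa(\zeta) = \Big\{ z \in \mathbb C : \log \lim_{n \to \infty} \sqrt[n]{|\kappa_n|}<\zeta\, \Re(z) < 0 \Big\},$$ where the limit is understood to exist. The Kampé de Fériet hypergeometric function of two variables is $$F_{g:c;d}^{h:p;q}\Big[ \begin{array}{c} (H_h):(A_p);(B_q) \\ (G_g):(C_c);(D_d) \end{array} \Big| \begin{array}{c} x \\ y \end{array} \Big] = \sum_{m,n \geq 0} \frac{((H_h))_{m+n}((A_p))_m((B_q))_n}{((G_g))_{m+n}((C_c))_m((D_d))_n}\, \frac{x^m}{m!}\, \frac{y^n}{n!},$$ where $(H_h)$ denotes a list of parameters $H_1,\dots,H_h$ and $((H_h))_n=(H_1)_n(H_2)_n\cdots(H_h)_n$, which is understood as $1$ when $n=0$; a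 dash denotes an empty parameter list (empty product $1$). Thus, explicitly, $$F_{2:0;1}^{1:1;2}\Big[ \begin{array}{c} H: A;\ B_1,B_2 \\ G_1,G_2:-;\ D \end{array} \Big| \begin{array}{c} x \\ y \end{array} \Big]=\sum_{m,n\ge0}\frac{(H)_{m+n}(A)_m(B_1)_n(B_2)_n}{(G_1)_{m+n}(G_2)_{m+n}(D)_n}\frac{x^m}{m!}\frac{y^n}{n!}.$$ The partial derivatives $\partial/\partial a$ and $\partial/\partial b$ of $M^*$ and $\boldsymbol\Gamma_0(s)$ are taken with $s,z,\alpha,\beta,\zeta$ fixed, regarding these quantities as functions of $(a,b)$. *)

theory Defs
  imports "HOL-Analysis.Analysis"
begin

(* The derivative is one-sided at 0; the values of f on negative reals play no role. *)
definition C1_on_Rplus :: "(real \<Rightarrow> complex) \<Rightarrow> bool" where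
  "C1_on_Rplus f \<longleftrightarrow>
     (\<exists>f'. (\<forall>x\<ge>0. (f has_vector_derivative f' x) (at x within {0..})) \<and>
           continuous_on {0..} f')"

(* The operator 1 + {x} d/dx on C^1 functions on the half-line. *)
definition dfrak :: "(real \<Rightarrow> complex) \<Rightarrow> real \<Rightarrow> complex" where
  "dfrak f x = f x + frac x *\<^sub>R vector_derivative f (at x within {0..})"

definition kummer_M :: "complex \<Rightarrow> complex \<Rightarrow> complex \<Rightarrow> complex" where
  "kummer_M a b z = (\<Sum>n. pochhammer a n / pochhammer b n * (z ^ n / fact n))"

(* Logarithm on [0,\<infinity>) with log 0 = -\<infinity>; the library's ln 0 = 0 would wrongly exclude
   coefficient sequences whose n-th roots tend to 0. *)
definition log_ext :: "real \<Rightarrow> ereal" where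
  "log_ext x = (if x = 0 then -\<infinity> else ereal (ln x))"

definition R_region :: "(nat \<Rightarrow> complex) \<Rightarrow> real \<Rightarrow> complex set" where
  "R_region k \<zeta> =
     {z. convergent (\<lambda>n. root n (cmod (k n))) \<and>
         log_ext (lim (\<lambda>n. root n (cmod (k n)))) < ereal (\<zeta> * Re z) \<and> \<zeta> * Re z < 0}"

definition poch_list :: "complex list \<Rightarrow> nat \<Rightarrow> complex" where
  "poch_list ps n = (\<Prod>p\<leftarrow>ps. pochhammer p n)"

(* Argument order: top row H : A ; B, bottom row G : C ; D, then the variables x, y. *)
definition kampe_de_feriet ::
  "complex list \<Rightarrow> complex list \<Rightarrow> complex list \<Rightarrow>
   complex list \<Rightarrow> complex list \<Rightarrow> complex list \<Rightarrow> complex \<Rightarrow> complex \<Rightarrow> complex" where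
  "kampe_de_feriet H A B G C D x y =
     (\<Sum>\<^sub>\<infinity>(m, n)\<in>UNIV.
        (poch_list H (m + n) * poch_list A m * poch_list B n) /
        (poch_list G (m + n) * poch_list C m * poch_list D n) *
        (x ^ m / fact m) * (y ^ n / fact n))"

definition kk_term ::
  "(nat \<Rightarrow> complex) \<Rightarrow> real \<Rightarrow> real \<Rightarrow> real \<Rightarrow> real \<Rightarrow> real \<Rightarrow> complex \<Rightarrow> nat \<Rightarrow> complex" where
  "kk_term k a b \<alpha> \<beta> \<zeta> z n =
     k n * kummer_M (of_real (a + \<alpha> * real n)) (of_real (b + \<beta> * real n))
                    (z * of_real (1 + \<zeta> * real n))"

definition kapteyn_kummer ::
  "(nat \<Rightarrow> complex) \<Rightarrow> real \<Rightarrow> real \<Rightarrow> real \<Rightarrow> real \<Rightarrow> real \<Rightarrow> complex \<Rightarrow> complex" where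
  "kapteyn_kummer k a b \<alpha> \<beta> \<zeta> z = (\<Sum>n. kk_term k a b \<alpha> \<beta> \<zeta> z n)"

definition M_star ::
  "real \<Rightarrow> real \<Rightarrow> real \<Rightarrow> complex \<Rightarrow> real \<Rightarrow> real \<Rightarrow> real \<Rightarrow> complex" where
  "M_star \<alpha> \<beta> \<zeta> z s a b =
     kummer_M (of_real (a + \<alpha> * s)) (of_real (b + \<beta> * s)) (z * of_real (1 + \<zeta> * s))"

definition Gamma_bold ::
  "nat \<Rightarrow> real \<Rightarrow> real \<Rightarrow> real \<Rightarrow> real \<Rightarrow> real \<Rightarrow> real" where
  "Gamma_bold \<rho> \<alpha> \<beta> s a b =
     Gamma (b - a + (\<beta> - \<alpha>) * s) * Gamma (a + \<alpha> * s + real \<rho>) / Gamma (b + \<beta> * s + real \<rho>)"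

definition gamma_weight ::
  "(real \<Rightarrow> complex) \<Rightarrow> real \<Rightarrow> real \<Rightarrow> real \<Rightarrow> real \<Rightarrow> real \<Rightarrow> complex" where
  "gamma_weight \<kappa> \<alpha> \<beta> a b u =
     \<kappa> u * of_real (Gamma (b + \<beta> * u) /
                   (Gamma (b - a + (\<beta> - \<alpha>) * u) * Gamma (a + \<alpha> * u)))"

(* The partial derivatives are ordinary real-variable derivatives in a or b alone. *)
definition kk_kernel ::
  "real \<Rightarrow> real \<Rightarrow> real \<Rightarrow> real \<Rightarrow> real \<Rightarrow> complex \<Rightarrow> real \<Rightarrow> complex" where
  "kk_kernel a b \<alpha> \<beta> \<zeta> z s =
     of_real \<zeta> * z * of_real (Gamma_bold 1 \<alpha> \<beta> s a b) *
       kummer_M (of_real (a + \<alpha> * s + 1)) (of_real (b + \<beta> * s + 1)) (z * of_real (1 + \<zeta> * s))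
     + M_star \<alpha> \<beta> \<zeta> z s a b *
       of_real (\<beta> * deriv (\<lambda>b'. Gamma_bold 0 \<alpha> \<beta> s a b') b
                + \<alpha> * deriv (\<lambda>a'. Gamma_bold 0 \<alpha> \<beta> s a' b) a)
     + of_real (Gamma_bold 0 \<alpha> \<beta> s a b) *
       (of_real \<beta> * vector_derivative (\<lambda>b'. M_star \<alpha> \<beta> \<zeta> z s a b') (at b)
        + of_real \<alpha> * vector_derivative (\<lambda>a'. M_star \<alpha> \<beta> \<zeta> z s a' b) (at a))"

definition kk_integrand ::
  "(real \<Rightarrow> complex) \<Rightarrow> real \<Rightarrow> real \<Rightarrow> real \<Rightarrow> real \<Rightarrow> real \<Rightarrow> complex \<Rightarrow> real \<Rightarrow> real \<Rightarrow> complex" where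
  "kk_integrand \<kappa> a b \<alpha> \<beta> \<zeta> z s u =
     dfrak (gamma_weight \<kappa> \<alpha> \<beta> a b) u * kk_kernel a b \<alpha> \<beta> \<zeta> z s"

end

theory Submission
  imports Defs "HOL-Complex_Analysis.Cauchy_Integral_Formula"
begin

text \<open>Write \<open>A(s) = a + \<alpha> s\<close>, \<open>C(s) = b - a + (\<beta> - \<alpha>) s\<close> and \<open>w(s) = z (1 + \<zeta> s)\<close>. Euler's integral
(\<open>Euler_integral_kummer\<close>) turns \<open>G(s) = \<Gamma>\<^sub>0(s) M(A(s), A(s) + C(s), w(s))\<close> into
\<open>\<integral> exp(w(s) t) t powr (A(s) - 1) (1 - t) powr (C(s) - 1) dt\<close> over the unit interval. All three
parameters are affine in \<open>s\<close>, so the integrand has the form \<open>F(t) exp(- \<mu>(t) s)\<close> with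
\<open>\<mu>(t) = - (\<zeta> z t + \<alpha> ln t + (\<beta> - \<alpha>) ln (1 - t))\<close>. The condition \<open>\<zeta> Re z < 0\<close> makes
\<open>Re \<mu>\<close> positive on the unit interval and \<open>\<bar>\<mu>\<bar>\<close> at most a constant times \<open>Re \<mu>\<close>.

The kernel in the theorem is \<open>G'\<close> written out by the product rule, that is
\<open>- \<integral> \<mu> F exp(- \<mu> s) dt\<close> (\<open>kk_kernel_eq_log_moment\<close>). Since each exponential can be integrated
explicitly over \<open>[x, \<infinity>)\<close>, Fubini's theorem shows without any asymptotics of \<open>M\<close> that the kernel
is absolutely integrable there, that its integral is \<open>- G(x)\<close>, and that the integral of its
modulus is at most a constant times \<open>\<Gamma>\<^sub>0(x)\<close> (\<open>kk_kernel_tail\<close>).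

Now let \<open>W\<close> be \<open>\<kappa>\<close> divided by \<open>\<Gamma>\<^sub>0\<close>, so that the \<open>n\<close>-th term of the series is \<open>W(n) G(n)\<close>.
Replace \<open>G(n)\<close> by the tail integral of the kernel for \<open>n \<ge> 1\<close> and exchange sum and integral
(\<open>partial_summation_integral\<close>): the kernel at \<open>s\<close> gets multiplied by the sum of
\<open>W(n)\<close> over \<open>1 \<le> n \<le> s\<close>. This sum is the inner integral, by the Euler--Maclaurin formula of
lowest order (\<open>dfrak_integral_eq_sum\<close>). The exchange is legitimate because
\<open>\<bar>W(n)\<bar> \<Gamma>\<^sub>0(n) = \<bar>\<kappa>\<^sub>n\<bar>\<close> and \<open>\<Sum> \<bar>\<kappa>\<^sub>n\<bar>\<close> converges by the root test: the logarithm of the limit of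
the \<open>n\<close>-th roots is below \<open>\<zeta> Re z\<close>, hence negative.

The formulas for the parameter derivatives of \<open>M\<close> come from differentiating the power series
term by term. The logarithmic derivative of a Pochhammer symbol is a finite sum
\<open>\<Sum> 1 / (c + j)\<close>; writing \<open>c / (c + j)\<close> as a quotient of Pochhammer symbols and summing the
resulting double series along its antidiagonals identifies it as a Kampe de Feriet function
(\<open>kampe_de_feriet_eq_digamma_series\<close>).\<close>

section \<open>Euler's integral for Kummer's function\<close>

definition beta_ker :: "real \<Rightarrow> real \<Rightarrow> real \<Rightarrow> real" where
  "beta_ker A C t = indicator {0<..<1} t * (t powr (A - 1) * (1 - t) powr (C - 1))"

definition euler_ker :: "real \<Rightarrow> real \<Rightarrow> complex \<Rightarrow> real \<Rightarrow> complex" where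
  "euler_ker A C w t = exp (w * of_real t) * of_real (beta_ker A C t)"

lemma beta_ker_nonneg: "beta_ker A C t \<ge> 0"
  by (simp add: beta_ker_def)

lemma beta_ker_measurable [measurable]: "beta_ker A C \<in> borel_measurable borel"
  unfolding beta_ker_def by measurable

lemma euler_ker_measurable [measurable]: "euler_ker A C w \<in> borel_measurable borel"
  unfolding euler_ker_def by measurable

lemma has_bochner_integral_beta_ker:
  assumes "A > 0" "C > 0"
  shows "has_bochner_integral lborel (beta_ker A C) (Beta A C)"
proof -
  let ?f = "\<lambda>t. t powr (A - 1) * (1 - t) powr (C - 1)"
  have i: "set_integrable lborel {0..1} ?f"
    using assms by (rule integrable_Beta)
  have v: "(LINT t:{0..1}|lborel. ?f t) = Beta A C"
    using set_borel_integral_eq_integral(2)[OF i] integral_unique[OF has_integral_Beta_real[OF assms]]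
    by simp
  have "has_bochner_integral lborel (\<lambda>t. indicator {0..1} t *\<^sub>R ?f t) (Beta A C)"
    using i v by (simp add: has_bochner_integral_iff set_integrable_def set_lebesgue_integral_def)
  moreover have "indicator {0..1} t *\<^sub>R ?f t = beta_ker A C t" for t
    by (cases "t = 0 \<or> t = 1") (auto simp: beta_ker_def indicator_def)
  ultimately show ?thesis by simp
qed

lemma norm_euler_ker: "norm (euler_ker A C w t) = exp (Re w * t) * beta_ker A C t"
  by (simp add: euler_ker_def norm_mult beta_ker_nonneg)

text \<open>Only an upper bound for \<open>Re w\<close> enters. This matters because along the series \<open>Re w\<close> tends to
\<open>-\<infinity>\<close>, while the bound has to stay uniform.\<close>

lemma norm_euler_ker_le:
  assumes "Re w \<le> c" "0 \<le> c"
  shows "norm (euler_ker A C w t) \<le> exp c * beta_ker A C t"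
proof (cases "0 < t \<and> t < 1")
  case True
  hence "Re w * t \<le> c * t" using assms by (intro mult_right_mono) auto
  also have "c * t \<le> c * 1" using True assms by (intro mult_left_mono) auto
  finally show ?thesis unfolding norm_euler_ker
    by (intro mult_right_mono beta_ker_nonneg) auto
qed (auto simp: norm_euler_ker beta_ker_def)

lemma integrable_beta_ker: "A > 0 \<Longrightarrow> C > 0 \<Longrightarrow> integrable lborel (beta_ker A C)"
  using has_bochner_integral_beta_ker has_bochner_integral_iff by blast

lemma integrable_euler_ker:
  assumes "A > 0" "C > 0"
  shows "integrable lborel (euler_ker A C w)"
proof (rule Bochner_Integration.integrable_bound)
  show "integrable lborel (\<lambda>t. exp \<bar>Re w\<bar> * beta_ker A C t)"
    using assms by (intro integrable_mult_right integrable_beta_ker)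
  show "AE t in lborel. norm (euler_ker A C w t) \<le> norm (exp \<bar>Re w\<bar> * beta_ker A C t)"
    using norm_euler_ker_le[of w "\<bar>Re w\<bar>" A C] by (simp add: beta_ker_nonneg)
qed simp

lemma integral_norm_euler_ker_le:
  assumes "A > 0" "C > 0" "Re w \<le> c" "0 \<le> c"
  shows "(\<integral>t. norm (euler_ker A C w t) \<partial>lborel) \<le> exp c * Beta A C"
proof -
  have "(\<integral>t. norm (euler_ker A C w t) \<partial>lborel) \<le> (\<integral>t. exp c * beta_ker A C t \<partial>lborel)"
    using assms by (intro integral_mono integrable_norm integrable_euler_ker integrable_mult_right
        integrable_beta_ker norm_euler_ker_le)
  also have "\<dots> = exp c * Beta A C"
    using has_bochner_integral_beta_ker[OF assms(1,2)] by (simp add: has_bochner_integral_iff)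
  finally show ?thesis .
qed

lemma Beta_pos: "A > 0 \<Longrightarrow> C > 0 \<Longrightarrow> Beta A C > (0 :: real)"
  by (simp add: Beta_def)

lemma Beta_pochhammer:
  fixes A C :: real
  assumes "A > 0" "C > 0"
  shows "Beta (A + of_nat n) C = Beta A C * (pochhammer A n / pochhammer (A + C) n)"
proof -
  have [simp]: "A \<notin> \<int>\<^sub>\<le>\<^sub>0" "A + C \<notin> \<int>\<^sub>\<le>\<^sub>0"
    using assms by (auto elim!: nonpos_Ints_cases)
  have "Gamma A > 0" "Gamma (A + C) > 0" using assms by auto
  thus ?thesis by (simp add: Beta_def pochhammer_Gamma field_simps)
qed

lemma beta_ker_times_power: "beta_ker A C t * t ^ n = beta_ker (A + of_nat n) C t"
proof (cases "0 < t \<and> t < 1")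
  case True
  hence "t powr (A + real n - 1) = t powr (A - 1) * t ^ n"
    by (simp add: powr_realpow[symmetric] powr_add[symmetric] algebra_simps)
  thus ?thesis by (simp add: beta_ker_def)
qed (auto simp: beta_ker_def)

text \<open>Expanding the exponential and integrating term by term gives Beta integrals with shifted first
argument, whose ratio to \<open>Beta A C\<close> is the quotient of Pochhammer symbols in Kummer's series.\<close>

lemma Euler_integral_kummer:
  assumes A: "A > 0" and C: "C > 0"
  shows "(\<integral>t. euler_ker A C w t \<partial>lborel)
         = of_real (Beta A C) * kummer_M (of_real A) (of_real (A + C)) w"
proof -
  let ?f = "\<lambda>n t. w ^ n / fact n * complex_of_real (beta_ker (A + of_nat n) C t)"
  have An: "A + of_nat n > 0" for n using A by simp
  have exp_sums: "(\<lambda>n. (w * of_real t) ^ n / fact n) sums exp (w * of_real t)" for t :: real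
    using exp_converges[of "w * of_real t"] by (simp add: scaleR_conv_of_real divide_inverse mult.commute)
  have f_eq: "?f n t = (w * of_real t) ^ n / fact n * of_real (beta_ker A C t)" for n t
    by (simp add: beta_ker_times_power[symmetric] power_mult_distrib)
  have sums_f: "(\<lambda>n. ?f n t) sums euler_ker A C w t" for t
    unfolding f_eq euler_ker_def by (intro sums_mult2 exp_sums)
  have int: "integrable lborel (?f n)" for n
    by (intro integrable_mult_right integrable_of_real integrable_beta_ker An C)
  have Beta_le: "Beta (A + of_nat n) C \<le> Beta A C" for n
    using A C by (intro Beta_real_mono) auto
  have norm_int: "(\<integral>t. norm (?f n t) \<partial>lborel) = norm w ^ n / fact n * Beta (A + of_nat n) C" for n
    using has_bochner_integral_beta_ker[OF An[of n] C]
    by (simp add: norm_mult norm_divide norm_power beta_ker_nonneg has_bochner_integral_iff)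
  have exps: "summable (\<lambda>n. norm w ^ n / fact n * Beta A C)"
    using summable_exp[of "norm w"] by (intro summable_mult2) (simp add: divide_inverse mult.commute)
  have summable_norm: "summable (\<lambda>n. norm (?f n t))" for t
  proof (rule summable_comparison_test)
    show "summable (\<lambda>n. norm w ^ n / fact n * beta_ker A C t)"
      using summable_exp[of "norm w"] by (intro summable_mult2) (simp add: divide_inverse mult.commute)
    have "beta_ker (A + of_nat n) C t \<le> beta_ker A C t" for n
    proof (cases "0 < t \<and> t < 1")
      case True
      thus ?thesis unfolding beta_ker_times_power[symmetric]
        by (intro mult_left_le power_le_one beta_ker_nonneg) auto
    qed (auto simp: beta_ker_def)
    thus "\<exists>N. \<forall>n\<ge>N. norm (norm (?f n t)) \<le> norm w ^ n / fact n * beta_ker A C t"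
      by (intro exI[of _ 0])
         (simp add: norm_mult norm_divide norm_power beta_ker_nonneg mult_left_mono divide_right_mono)
  qed
  have summable_int: "summable (\<lambda>n. \<integral>t. norm (?f n t) \<partial>lborel)"
    unfolding norm_int
    by (rule summable_comparison_test[OF _ exps])
       (use A C Beta_le in \<open>auto intro!: exI[of _ 0] mult_left_mono divide_right_mono
           simp: abs_mult Beta_pos less_imp_le\<close>)
  have "(\<lambda>n. \<integral>t. ?f n t \<partial>lborel) sums (\<integral>t. (\<Sum>n. ?f n t) \<partial>lborel)"
    by (intro sums_integral int summable_int AE_I2 summable_norm)
  also have "(\<lambda>t. \<Sum>n. ?f n t) = euler_ker A C w"
    using sums_f by (auto simp: sums_iff fun_eq_iff)
  finally have main: "(\<lambda>n. \<integral>t. ?f n t \<partial>lborel) sums (\<integral>t. euler_ker A C w t \<partial>lborel)" .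
  have coeff: "(\<integral>t. ?f n t \<partial>lborel) =
     of_real (Beta A C) * (pochhammer (of_real A) n / pochhammer (of_real (A + C)) n * (w ^ n / fact n))" for n
  proof -
    have "(\<integral>t. ?f n t \<partial>lborel) = w ^ n / fact n * of_real (Beta (A + of_nat n) C)"
      using has_bochner_integral_beta_ker[OF An[of n] C] by (simp add: has_bochner_integral_iff)
    also have "Beta (A + of_nat n) C = Beta A C * (pochhammer A n / pochhammer (A + C) n)"
      using A C by (rule Beta_pochhammer)
    finally show ?thesis by (simp only: of_real_mult of_real_divide pochhammer_of_real mult_ac)
  qed
  have nz: "complex_of_real (Beta A C) \<noteq> 0"
    using Beta_pos[OF A C] by simp
  have s: "summable (\<lambda>n. pochhammer (of_real A) n / pochhammer (of_real (A + C)) n * (w ^ n / fact n) :: complex)"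
    using sums_summable[OF main] unfolding coeff summable_cmult_iff using nz by simp
  show "(\<integral>t. euler_ker A C w t \<partial>lborel)
         = of_real (Beta A C) * kummer_M (of_real A) (of_real (A + C)) w"
    using sums_unique[OF main] unfolding coeff kummer_M_def suminf_mult[OF s] by simp
qed

section \<open>Parameter derivatives of Kummer's function\<close>

lemma has_field_derivative_pochhammer:
  fixes a :: "'a :: real_normed_field"
  assumes "\<And>j. j < n \<Longrightarrow> a + of_nat j \<noteq> 0"
  shows "((\<lambda>a. pochhammer a n) has_field_derivative
            pochhammer a n * (\<Sum>j<n. 1 / (a + of_nat j))) (at a)"
  using assms
proof (induction n)
  case (Suc n)
  have "((\<lambda>a. pochhammer a n * (a + of_nat n)) has_field_derivative
          pochhammer a n * (\<Sum>j<n. 1 / (a + of_nat j)) * (a + of_nat n) + 1 * pochhammer a n) (at a)"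
    using Suc by (intro DERIV_mult) (auto intro!: derivative_eq_intros)
  moreover have "a + of_nat n \<noteq> 0" using Suc.prems by blast
  ultimately have "((\<lambda>a. pochhammer a n * (a + of_nat n)) has_field_derivative
          pochhammer a n * (a + of_nat n) * ((\<Sum>j<n. 1 / (a + of_nat j)) + 1 / (a + of_nat n))) (at a)"
    by (elim DERIV_cong) (simp add: field_simps)
  thus ?case by (simp add: pochhammer_Suc)
qed simp

text \<open>The factors satisfy \<open>\<bar>a + j\<bar> \<le> q Re (b + j)\<close> for every \<open>j\<close> as soon as they do for \<open>j = 0\<close>,
because \<open>q \<ge> 1\<close>. Kummer's series is thus dominated by an exponential series, uniformly
in the parameters; this is what makes termwise differentiation possible.\<close>

lemma norm_pochhammer_ratio_le:
  fixes a b :: complex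
  assumes "norm a \<le> q * Re b" "q \<ge> 1" "Re b > 0"
  shows "norm (pochhammer a n / pochhammer b n) \<le> q ^ n"
proof (induction n)
  case (Suc n)
  have pos: "norm (b + of_nat n) > 0"
    using assms(3) by (auto simp: complex_eq_iff)
  have "norm (a + of_nat n) \<le> norm a + real n"
    by (metis norm_of_nat norm_triangle_ineq)
  also have "\<dots> \<le> q * Re b + q * real n"
    using assms by (intro add_mono) (auto simp: mult_left_mono mult_le_cancel_right1)
  also have "\<dots> = q * Re (b + of_nat n)" by (simp add: algebra_simps)
  also have "\<dots> \<le> q * norm (b + of_nat n)"
    using assms by (intro mult_left_mono complex_Re_le_cmod) auto
  finally have "norm ((a + of_nat n) / (b + of_nat n)) \<le> q"
    using pos by (simp add: norm_divide divide_le_eq)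
  hence "norm (pochhammer a n / pochhammer b n) * norm ((a + of_nat n) / (b + of_nat n)) \<le> q ^ n * q"
    using Suc assms by (intro mult_mono) auto
  thus ?case by (simp add: pochhammer_Suc norm_mult norm_divide mult.commute)
qed simp

lemma add_of_nat_neq_0:
  assumes "Re a > 0"
  shows "a + of_nat j \<noteq> 0"
  using assms by (auto simp: complex_eq_iff)

lemma pochhammer_neq_0:
  assumes "Re a > 0"
  shows "pochhammer a n \<noteq> 0"
  using assms by (auto simp: pochhammer_eq_0_iff)

lemma summable_exp_bound: "summable (\<lambda>n. q ^ n * (norm w ^ n / fact n) :: real)"
proof -
  have "summable (\<lambda>n. (q * norm w) ^ n / fact n)"
    using summable_exp[of "q * norm w"] by (simp add: divide_inverse mult.commute)
  thus ?thesis by (simp add: power_mult_distrib)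
qed

lemma kummer_M_term_le:
  assumes "norm a \<le> q * Re b" "q \<ge> 1" "Re b > 0"
  shows "norm (pochhammer a n / pochhammer b n * (w ^ n / fact n)) \<le> q ^ n * (norm w ^ n / fact n)"
proof -
  have "norm (pochhammer a n / pochhammer b n) * norm (w ^ n / fact n) \<le> q ^ n * (norm w ^ n / fact n)"
    using norm_pochhammer_ratio_le[OF assms, of n] assms
    by (intro mult_mono) (auto simp: norm_divide norm_power)
  thus ?thesis by (simp only: norm_mult)
qed

text \<open>On a bounded part of the half-plane \<open>Re x > 0\<close> the series has one exponential majorant, and for
series of holomorphic functions this already allows termwise differentiation. The same argument
gives the derivative in the denominator parameter, where a half-plane bounded away from 0 is used.\<close>

lemma kummer_M_has_field_derivative_a:
  assumes "Re a > 0" "Re b > 0"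
  shows "\<exists>D. (\<lambda>n. pochhammer a n / pochhammer b n * (w ^ n / fact n) * (\<Sum>j<n. 1 / (a + of_nat j))) sums D
           \<and> ((\<lambda>a. kummer_M a b w) has_field_derivative D) (at a)"
proof -
  define S where "S = {x. Re x > 0} \<inter> {x. norm x < norm a + 1}"
  define q where "q = max 1 ((norm a + 1) / Re b)"
  have "q * Re b \<ge> (norm a + 1) / Re b * Re b"
    unfolding q_def using assms by (intro mult_right_mono) auto
  hence q: "q \<ge> 1" "norm a + 1 \<le> q * Re b"
    using assms by (auto simp: q_def)
  have op: "open S" unfolding S_def
    by (intro open_Int open_Collect_less continuous_intros)
  have aS: "a \<in> S" using assms by (auto simp: S_def)
  let ?f = "\<lambda>n x. pochhammer x n / pochhammer b n * (w ^ n / fact n)"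
  let ?f' = "\<lambda>n x. ?f n x * (\<Sum>j<n. 1 / (x + of_nat j))"
  obtain g g' where g: "\<forall>x\<in>S. (\<lambda>n. ?f n x) sums g x \<and> (\<lambda>n. ?f' n x) sums g' x
      \<and> (g has_field_derivative g' x) (at x)"
  proof (rule series_and_derivative_comparison[OF op summable_exp_bound[of q w], of ?f ?f'])
    show "(?f n has_field_derivative ?f' n x) (at x)" if "x \<in> S" for n x
    proof -
      have "((\<lambda>x. pochhammer x n * (w ^ n / fact n / pochhammer b n)) has_field_derivative
              pochhammer x n * (\<Sum>j<n. 1 / (x + of_nat j)) * (w ^ n / fact n / pochhammer b n)) (at x)"
        using that by (intro DERIV_cmult_right has_field_derivative_pochhammer add_of_nat_neq_0) (auto simp: S_def)
      thus ?thesis by (simp add: mult_ac)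
    qed
    show "\<forall>\<^sub>F n in sequentially. \<forall>x\<in>S. norm (?f n x) \<le> q ^ n * (norm w ^ n / fact n)"
    proof (intro always_eventually allI ballI kummer_M_term_le q assms)
      fix x assume "x \<in> S"
      thus "norm x \<le> q * Re b" using q by (auto simp: S_def)
    qed
  qed
  have "((\<lambda>a. kummer_M a b w) has_field_derivative g' a) (at a)"
  proof (rule has_field_derivative_transform_within_open[OF _ op aS])
    show "(g has_field_derivative g' a) (at a)" using g aS by blast
    show "g x = kummer_M x b w" if "x \<in> S" for x
      using g that by (auto simp: kummer_M_def sums_iff)
  qed
  thus ?thesis using g aS by blast
qed

lemma kummer_M_has_field_derivative_b:
  assumes "Re b > 0"
  shows "\<exists>D. (\<lambda>n. pochhammer a n / pochhammer b n * (w ^ n / fact n) * (\<Sum>j<n. 1 / (b + of_nat j))) sums D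
           \<and> ((\<lambda>b. kummer_M a b w) has_field_derivative - D) (at b)"
proof -
  define S where "S = {x. Re x > Re b / 2}"
  define q where "q = max 1 (norm a / (Re b / 2))"
  have "q * (Re b / 2) \<ge> norm a / (Re b / 2) * (Re b / 2)"
    unfolding q_def using assms by (intro mult_right_mono) auto
  hence q: "q \<ge> 1" "norm a \<le> q * (Re b / 2)"
    using assms by (auto simp: q_def)
  have op: "open S" unfolding S_def
    by (intro open_Collect_less continuous_intros)
  have bS: "b \<in> S" using assms by (auto simp: S_def)
  have pos: "Re x > 0" if "x \<in> S" for x using that assms by (auto simp: S_def)
  let ?f = "\<lambda>n x. pochhammer a n / pochhammer x n * (w ^ n / fact n)"
  let ?f' = "\<lambda>n x. - (?f n x * (\<Sum>j<n. 1 / (x + of_nat j)))"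
  obtain g g' where g: "\<forall>x\<in>S. (\<lambda>n. ?f n x) sums g x \<and> (\<lambda>n. ?f' n x) sums g' x
      \<and> (g has_field_derivative g' x) (at x)"
  proof (rule series_and_derivative_comparison[OF op summable_exp_bound[of q w], of ?f ?f'])
    show "(?f n has_field_derivative ?f' n x) (at x)" if "x \<in> S" for n x
    proof -
      have nz: "pochhammer x n \<noteq> 0"
        using pos[OF that] by (rule pochhammer_neq_0)
      have "((\<lambda>x. (pochhammer a n * (w ^ n / fact n)) * inverse (pochhammer x n)) has_field_derivative
              (pochhammer a n * (w ^ n / fact n)) * - (inverse (pochhammer x n) *
                (pochhammer x n * (\<Sum>j<n. 1 / (x + of_nat j))) * inverse (pochhammer x n))) (at x)"
        using pos[OF that] nz
        by (intro DERIV_cmult DERIV_inverse' has_field_derivative_pochhammer add_of_nat_neq_0) auto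
      thus ?thesis using nz by (simp add: field_simps)
    qed
    show "\<forall>\<^sub>F n in sequentially. \<forall>x\<in>S. norm (?f n x) \<le> q ^ n * (norm w ^ n / fact n)"
    proof (intro always_eventually allI ballI kummer_M_term_le q pos)
      fix x assume "x \<in> S"
      hence "q * (Re b / 2) \<le> q * Re x" using q by (intro mult_left_mono) (auto simp: S_def)
      thus "norm a \<le> q * Re x" using q by linarith
    qed
  qed
  have "((\<lambda>b. kummer_M a b w) has_field_derivative g' b) (at b)"
  proof (rule has_field_derivative_transform_within_open[OF _ op bS])
    show "(g has_field_derivative g' b) (at b)" using g bS by blast
    show "g x = kummer_M a x w" if "x \<in> S" for x
      using g that by (auto simp: kummer_M_def sums_iff)
  qed
  moreover have "(\<lambda>n. ?f n b * (\<Sum>j<n. 1 / (b + of_nat j))) sums (- g' b)"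
    using sums_minus[of "\<lambda>n. ?f' n b" "g' b"] g bS by simp
  ultimately show ?thesis by (intro exI[of _ "- g' b"]) auto
qed

text \<open>Taking \<open>c = a\<close> or \<open>c = b\<close> covers both parameter derivatives. With \<open>N = m + n\<close>, the
quotient of \<open>pochhammer c n\<close> and \<open>pochhammer (c + 1) n\<close> collapses to \<open>c / (c + n)\<close>, the Pochhammer
symbols of 1 cancel the factorials, and \<open>pochhammer 2 N\<close> is \<open>fact (Suc N)\<close>. So
each antidiagonal of the double series is one term of the single series. The index is shifted
by one because the term for \<open>n = 0\<close> of the single series has an empty inner sum.\<close>

lemma kampe_de_feriet_eq_digamma_series:
  fixes a b c :: complex
  assumes a: "Re a > 0" and b: "Re b > 0" and c: "Re c > 0"
    and D: "(\<lambda>n. pochhammer a n / pochhammer b n * (w ^ n / fact n) * (\<Sum>j<n. 1 / (c + of_nat j))) sums D"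
  shows "D = a * w / (b * c) * kampe_de_feriet [a + 1] [1] [1, c] [2, b + 1] [] [c + 1] w w"
proof -
  define T where "T = (\<lambda>N n. pochhammer (a + 1) N / pochhammer (b + 1) N * (w ^ N / fact (Suc N)) * (c / (c + of_nat n)))"
  define f where "f = (\<lambda>(m, n). (poch_list [a + 1] (m + n) * poch_list [1] m * poch_list [1, c] n) /
        (poch_list [2, b + 1] (m + n) * poch_list [] m * poch_list [c + 1] n) *
        (w ^ m / fact m) * (w ^ n / fact n))"
  have nz: "x + of_nat n \<noteq> 0" if "Re x > 0" for x n using add_of_nat_neq_0[OF that] .
  have a0: "a \<noteq> 0" "b \<noteq> 0" "c \<noteq> 0" using a b c by auto
  have p1: "pochhammer 1 n = (fact n :: complex)" for n by (simp add: pochhammer_fact)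
  have p2: "pochhammer 2 n = (fact (Suc n) :: complex)" for n
    using pochhammer_rec[of "1::complex" n] p1[of "Suc n"] by simp
  have pc: "pochhammer c n / pochhammer (c + 1) n = c / (c + of_nat n)" for n
  proof -
    have "c * pochhammer (c + 1) n = pochhammer c n * (c + of_nat n)"
      using pochhammer_rec[of c n] pochhammer_Suc[of c n] by simp
    moreover have "pochhammer (c + 1) n \<noteq> 0" using c by (intro pochhammer_neq_0) auto
    ultimately show ?thesis using nz[OF c, of n] by (simp add: field_simps)
  qed
  have fT: "f (N - n, n) = T N n" if "n \<le> N" for N n
  proof -
    have "f (N - n, n) = pochhammer (a + 1) N / pochhammer (b + 1) N / fact (Suc N)
             * (pochhammer c n / pochhammer (c + 1) n) * (w ^ (N - n) * w ^ n)"
      using that by (simp add: f_def poch_list_def p1 p2 mult_ac)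
    also have "w ^ (N - n) * w ^ n = w ^ N" using that by (simp add: power_add[symmetric])
    finally show ?thesis by (simp add: pc T_def mult_ac)
  qed
  have bij: "bij_betw (\<lambda>(N, n). (N - n, n)) (SIGMA N:UNIV. {..N}) (UNIV :: (nat \<times> nat) set)"
    by (rule bij_betwI[where g = "\<lambda>(m, n). (m + n, n)"]) auto
  \<comment> \<open>The least constant allowed in the majorant for the quotients of Pochhammer symbols.\<close>
  define q where "q = max 1 (norm (a + 1) / Re (b + 1))"
  have "q * Re (b + 1) \<ge> norm (a + 1) / Re (b + 1) * Re (b + 1)"
    unfolding q_def using b by (intro mult_right_mono) auto
  hence q: "q \<ge> 1" "norm (a + 1) \<le> q * Re (b + 1)"
    using b by (auto simp: q_def)
  \<comment> \<open>Each antidiagonal has \<open>Suc N\<close> entries of this size, which turns \<open>fact (Suc N)\<close> into \<open>fact N\<close>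
    and leaves an exponential majorant for the antidiagonal sums.\<close>
  have normT: "norm (T N n) \<le> q ^ N * (norm w ^ N / fact (Suc N)) * (norm c / Re c)" for N n
  proof -
    have "norm (c / (c + of_nat n)) \<le> norm c / Re c"
      using c complex_Re_le_cmod[of "c + of_nat n"] unfolding norm_divide
      by (intro divide_left_mono) (auto intro!: mult_pos_pos nz)
    moreover have "norm (pochhammer (a + 1) N / pochhammer (b + 1) N) \<le> q ^ N"
      using b by (intro norm_pochhammer_ratio_le q) auto
    ultimately have "norm (pochhammer (a + 1) N / pochhammer (b + 1) N) * (norm w ^ N / fact (Suc N)) * norm (c / (c + of_nat n))
         \<le> q ^ N * (norm w ^ N / fact (Suc N)) * (norm c / Re c)"
      using q c by (intro mult_mono) auto
    thus ?thesis unfolding T_def norm_mult by (simp add: norm_divide norm_power del: fact_Suc)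
  qed
  have T_abs: "(\<lambda>x. norm (case x of (N, n) \<Rightarrow> T N n)) summable_on (SIGMA N:UNIV. {..N})"
    unfolding Infinite_Sum.abs_summable_on_Sigma_iff
  proof (intro conjI ballI)
    show "(\<lambda>N. norm (\<Sum>\<^sub>\<infinity>n\<in>{..N}. norm (case (N, n) of (N, n) \<Rightarrow> T N n))) summable_on UNIV"
    proof (rule Infinite_Sum.abs_summable_on_comparison_test[where g = "\<lambda>N. q ^ N * (norm w ^ N / fact N) * (norm c / Re c)"])
      have "summable (\<lambda>N. q ^ N * (norm w ^ N / fact N) * (norm c / Re c))"
        by (intro summable_mult2 summable_exp_bound)
      thus "(\<lambda>N. norm (q ^ N * (norm w ^ N / fact N) * (norm c / Re c))) summable_on UNIV"
        using q c by (intro norm_summable_imp_summable_on) (simp add: abs_mult)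
      fix N
      have "(\<Sum>n\<le>N. norm (T N n)) \<le> (\<Sum>n\<le>N. q ^ N * (norm w ^ N / fact (Suc N)) * (norm c / Re c))"
        by (intro sum_mono normT)
      also have "\<dots> = q ^ N * (norm w ^ N / fact N) * (norm c / Re c)"
        using of_nat_neq_0[of N, where 'a = real] by (simp add: fact_Suc del: of_nat_Suc)
      finally have le: "(\<Sum>n\<le>N. norm (T N n)) \<le> \<bar>q ^ N * (norm w ^ N / fact N) * (norm c / Re c)\<bar>"
        by (rule order_trans[OF _ abs_ge_self])
      have "norm (\<Sum>\<^sub>\<infinity>n\<in>{..N}. norm (case (N, n) of (N, n) \<Rightarrow> T N n)) = (\<Sum>n\<le>N. norm (T N n))"
        by (simp add: sum_nonneg)
      thus "norm (\<Sum>\<^sub>\<infinity>n\<in>{..N}. norm (case (N, n) of (N, n) \<Rightarrow> T N n))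
           \<le> norm (q ^ N * (norm w ^ N / fact N) * (norm c / Re c))"
        unfolding real_norm_def using le by simp
    qed
  qed simp
  hence T_sum: "(\<lambda>(N, n). T N n) summable_on (SIGMA N:UNIV. {..N})"
    by (rule abs_summable_summable)
  have "((\<lambda>(N, n). T N n) has_sum infsum (\<lambda>(N, n). T N n) (SIGMA N:UNIV. {..N})) (SIGMA N:UNIV. {..N})"
    using T_sum by simp
  hence "((\<lambda>N. \<Sum>n\<le>N. T N n) has_sum infsum (\<lambda>(N, n). T N n) (SIGMA N:UNIV. {..N})) UNIV"
    by (rule has_sum_Sigma') (auto intro: has_sum_finite)
  hence sums1: "(\<lambda>N. \<Sum>n\<le>N. T N n) sums infsum (\<lambda>(N, n). T N n) (SIGMA N:UNIV. {..N})"
    by (rule has_sum_imp_sums)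
  have "infsum (\<lambda>(N, n). T N n) (SIGMA N:UNIV. {..N})
      = infsum (\<lambda>x. f ((\<lambda>(N, n). (N - n, n)) x)) (SIGMA N:UNIV. {..N})"
    by (intro infsum_cong) (auto simp: fT)
  also have "\<dots> = infsum f UNIV" by (rule infsum_reindex_bij_betw[OF bij])
  also have "\<dots> = kampe_de_feriet [a + 1] [1] [1, c] [2, b + 1] [] [c + 1] w w"
    by (simp add: kampe_de_feriet_def f_def)
  finally have sums2: "(\<lambda>N. \<Sum>n\<le>N. T N n) sums kampe_de_feriet [a + 1] [1] [1, c] [2, b + 1] [] [c + 1] w w"
    using sums1 by simp
  have eq: "pochhammer a (Suc N) / pochhammer b (Suc N) * (w ^ Suc N / fact (Suc N)) * (\<Sum>j<Suc N. 1 / (c + of_nat j))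
        = a * w / (b * c) * (\<Sum>n\<le>N. T N n)" for N
    unfolding T_def sum_distrib_left lessThan_Suc_atMost
    using a0 by (intro sum.cong) (simp_all add: pochhammer_rec mult_ac del: fact_Suc)
  have "(\<lambda>N. a * w / (b * c) * (\<Sum>n\<le>N. T N n)) sums D"
    using D unfolding eq[symmetric] by (subst sums_Suc_iff) simp
  from sums_unique2[OF this sums_mult[OF sums2]] show ?thesis .
qed

lemma vector_derivative_kummer_M_a:
  fixes A B :: real
  assumes "A > 0" "B > 0"
  shows "((\<lambda>x. kummer_M (of_real x) (of_real B) w) has_vector_derivative
           (w / of_real B * kampe_de_feriet [of_real (A + 1)] [1] [1, of_real A]
              [2, of_real (B + 1)] [] [of_real (A + 1)] w w)) (at A)"
proof -
  obtain D where D: "(\<lambda>n. pochhammer (of_real A) n / pochhammer (of_real B) n * (w ^ n / fact n) * (\<Sum>j<n. 1 / (of_real A + of_nat j))) sums D"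
    "((\<lambda>a. kummer_M a (of_real B) w) has_field_derivative D) (at (of_real A))"
    using kummer_M_has_field_derivative_a[of "of_real A" "of_real B" w] assms by auto
  have "D = w / of_real B * kampe_de_feriet [of_real (A + 1)] [1] [1, of_real A]
              [2, of_real (B + 1)] [] [of_real (A + 1)] w w"
    using kampe_de_feriet_eq_digamma_series[OF _ _ _ D(1)] assms by simp
  thus ?thesis using has_vector_derivative_real_field[OF D(2)] by simp
qed

lemma vector_derivative_kummer_M_b:
  fixes A B :: real
  assumes "A > 0" "B > 0"
  shows "((\<lambda>x. kummer_M (of_real A) (of_real x) w) has_vector_derivative
           (- (of_real A * w / (of_real B)\<^sup>2) * kampe_de_feriet [of_real (A + 1)] [1] [1, of_real B]
              [2, of_real (B + 1)] [] [of_real (B + 1)] w w)) (at B)"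
proof -
  obtain D where D: "(\<lambda>n. pochhammer (of_real A) n / pochhammer (of_real B) n * (w ^ n / fact n) * (\<Sum>j<n. 1 / (of_real B + of_nat j))) sums D"
    "((\<lambda>b. kummer_M (of_real A) b w) has_field_derivative - D) (at (of_real B))"
    using kummer_M_has_field_derivative_b[of "of_real B" "of_real A" w] assms by auto
  have "- D = - (of_real A * w / (of_real B)\<^sup>2) * kampe_de_feriet [of_real (A + 1)] [1] [1, of_real B]
              [2, of_real (B + 1)] [] [of_real (B + 1)] w w"
    using kampe_de_feriet_eq_digamma_series[OF _ _ _ D(1)] assms by (simp add: power2_eq_square)
  thus ?thesis using has_vector_derivative_real_field[OF D(2)] by simp
qed

section \<open>Parameter derivatives of Euler's integral\<close>

text \<open>Differentiation under the integral sign for an exponential family. The quadratic remainder bound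
\<open>\<bar>exp y - 1 - y\<bar> \<le> exp \<bar>y\<bar> y\<^sup>2\<close> controls the difference quotient directly, with an error of
order \<open>x\<^sup>2\<close> after integration, so one exponential moment of \<open>\<nu>\<close> suffices.\<close>

lemma has_vector_derivative_integral_exp:
  fixes F :: "'a :: euclidean_space \<Rightarrow> complex" and \<nu> :: "'a \<Rightarrow> real"
  assumes [measurable]: "F \<in> borel_measurable M" "\<nu> \<in> borel_measurable M"
    and \<epsilon>: "\<epsilon> > 0" and int: "integrable M (\<lambda>t. norm (F t) * exp (\<epsilon> * \<bar>\<nu> t\<bar>))"
  shows "((\<lambda>x. \<integral>t. F t * of_real (exp (x * \<nu> t)) \<partial>M) has_vector_derivative
           (\<integral>t. of_real (\<nu> t) * F t \<partial>M)) (at 0)"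
    and "integrable M (\<lambda>t. of_real (\<nu> t) * F t)"
proof -
  let ?E = "\<lambda>t. norm (F t) * exp (\<epsilon> * \<bar>\<nu> t\<bar>)"
  \<comment> \<open>Half of the exponential moment pays for the factor \<open>exp \<bar>y\<bar>\<close>, the other half for \<open>y\<^sup>2\<close>.\<close>
  define \<delta> where "\<delta> = \<epsilon> / 2"
  have \<delta>: "\<delta> > 0" using \<epsilon> by (simp add: \<delta>_def)
  have small: "integrable M (\<lambda>t. F t * of_real (exp (x * \<nu> t)))" if "\<bar>x\<bar> \<le> \<epsilon>" for x
  proof (rule Bochner_Integration.integrable_bound[OF int], measurable, rule AE_I2)
    fix t
    have "x * \<nu> t \<le> \<bar>x\<bar> * \<bar>\<nu> t\<bar>" by (metis abs_ge_self abs_mult)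
    also have "\<dots> \<le> \<epsilon> * \<bar>\<nu> t\<bar>" using that by (intro mult_right_mono) auto
    finally show "norm (F t * of_real (exp (x * \<nu> t))) \<le> norm (?E t)"
      by (simp add: norm_mult mult_left_mono)
  qed
  have y_le: "\<bar>\<nu> t\<bar> \<le> 1 / \<epsilon> * exp (\<epsilon> * \<bar>\<nu> t\<bar>)" for t
    using exp_ge_add_one_self[of "\<epsilon> * \<bar>\<nu> t\<bar>"] \<epsilon> by (simp add: pos_le_divide_eq mult.commute del: exp_ge_add_one_self)
  show i\<nu>: "integrable M (\<lambda>t. of_real (\<nu> t) * F t)"
  proof (rule Bochner_Integration.integrable_bound[OF integrable_mult_right[OF int, of "1/\<epsilon>"]], measurable, rule AE_I2)
    fix t
    have "norm (F t) * \<bar>\<nu> t\<bar> \<le> norm (F t) * (1 / \<epsilon> * exp (\<epsilon> * \<bar>\<nu> t\<bar>))"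
      by (intro mult_left_mono y_le) auto
    thus "norm (of_real (\<nu> t) * F t) \<le> norm (1 / \<epsilon> * ?E t)"
      using \<epsilon> by (simp add: norm_mult mult_ac)
  qed
  define K where "K = 2 / \<delta>\<^sup>2"
  have K0: "K \<ge> 0" by (simp add: K_def)
  define I where "I = (\<integral>t. ?E t \<partial>M)"
  let ?G = "\<lambda>x. \<integral>t. F t * of_real (exp (x * \<nu> t)) \<partial>M"
  let ?D = "\<integral>t. of_real (\<nu> t) * F t \<partial>M"
  have est: "norm (?G x - ?G 0 - x *\<^sub>R ?D) \<le> x\<^sup>2 * (K * I)" if x: "\<bar>x\<bar> \<le> \<delta>" for x
  proof -
    have x': "\<bar>x\<bar> \<le> \<epsilon>" using x \<epsilon> unfolding \<delta>_def by linarith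
    have "?G x - ?G 0 - x *\<^sub>R ?D = (\<integral>t. F t * of_real (exp (x * \<nu> t)) - F t * of_real (exp (0 * \<nu> t)) - x *\<^sub>R (of_real (\<nu> t) * F t) \<partial>M)"
      using small[OF x'] small[of 0] \<epsilon> i\<nu>
      by (simp add: Bochner_Integration.integral_diff)
    also have "norm \<dots> \<le> (\<integral>t. x\<^sup>2 * (K * ?E t) \<partial>M)"
    proof (rule Bochner_Integration.integral_norm_bound_integral)
      show "integrable M (\<lambda>t. F t * of_real (exp (x * \<nu> t)) - F t * of_real (exp (0 * \<nu> t)) - x *\<^sub>R (of_real (\<nu> t) * F t))"
        using \<epsilon> by (intro Bochner_Integration.integrable_diff small x' integrable_scaleR_right i\<nu>) auto
      show "integrable M (\<lambda>t. x\<^sup>2 * (K * ?E t))"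
        by (intro integrable_mult_right int)
      fix t
      define y where "y = x * \<nu> t"
      have "norm (exp y - (\<Sum>k\<le>1. y ^ k / fact k)) \<le> exp \<bar>y\<bar> * (norm y ^ Suc 1) / fact 1"
        using Taylor_exp_field[of y 1] by simp
      hence "\<bar>exp y - 1 - y\<bar> \<le> exp \<bar>y\<bar> * y\<^sup>2"
        using exp_ge_add_one_self[of y] by (simp add: power2_eq_square abs_of_nonneg del: exp_ge_add_one_self)
      also have "\<dots> \<le> exp (\<delta> * \<bar>\<nu> t\<bar>) * (x\<^sup>2 * (K * exp (\<delta> * \<bar>\<nu> t\<bar>)))"
      proof (intro mult_mono)
        show "exp \<bar>y\<bar> \<le> exp (\<delta> * \<bar>\<nu> t\<bar>)"
          using x by (simp add: y_def abs_mult mult_right_mono)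
        have "(\<delta> * \<bar>\<nu> t\<bar>)\<^sup>2 / 2 \<le> exp (\<delta> * \<bar>\<nu> t\<bar>)"
          using exp_lower_Taylor_quadratic[of "\<delta> * \<bar>\<nu> t\<bar>"] \<delta>
          by (smt (verit) mult_nonneg_nonneg abs_ge_zero)
        hence "(\<nu> t)\<^sup>2 \<le> K * exp (\<delta> * \<bar>\<nu> t\<bar>)"
          using \<delta> by (simp add: K_def field_simps power_mult_distrib)
        thus "y\<^sup>2 \<le> x\<^sup>2 * (K * exp (\<delta> * \<bar>\<nu> t\<bar>))"
          unfolding y_def power_mult_distrib by (intro mult_left_mono) auto
      qed auto
      also have "\<dots> = x\<^sup>2 * (K * exp (\<epsilon> * \<bar>\<nu> t\<bar>))"
        by (simp add: \<delta>_def exp_add[symmetric] field_simps)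
      finally have "norm (F t) * \<bar>exp y - 1 - y\<bar> \<le> norm (F t) * (x\<^sup>2 * (K * exp (\<epsilon> * \<bar>\<nu> t\<bar>)))"
        by (intro mult_left_mono) auto
      moreover have "F t * of_real (exp (x * \<nu> t)) - F t * of_real (exp (0 * \<nu> t)) - x *\<^sub>R (of_real (\<nu> t) * F t)
          = F t * of_real (exp y - 1 - y)"
        by (simp add: y_def scaleR_conv_of_real algebra_simps exp_of_real)
      ultimately show "norm (F t * of_real (exp (x * \<nu> t)) - F t * of_real (exp (0 * \<nu> t)) - x *\<^sub>R (of_real (\<nu> t) * F t)) \<le> x\<^sup>2 * (K * ?E t)"
        by (simp only: norm_mult norm_of_real) (simp add: mult_ac)
    qed
    finally show ?thesis by (simp add: I_def)
  qed
  show "(?G has_vector_derivative ?D) (at 0)"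
    unfolding has_vector_derivative_def has_derivative_at
  proof (intro conjI bounded_linear_scaleR_left)
    have "((\<lambda>h. \<bar>h\<bar> * (K * I)) \<longlongrightarrow> \<bar>0\<bar> * (K * I)) (at (0::real))"
      by (intro tendsto_intros)
    hence lim: "((\<lambda>h. \<bar>h\<bar> * (K * I)) \<longlongrightarrow> 0) (at (0::real))" by simp
    have ev: "\<forall>\<^sub>F h in at 0. norm (norm (?G (0 + h) - ?G 0 - h *\<^sub>R ?D) / norm h) \<le> \<bar>h\<bar> * (K * I)"
      unfolding eventually_at
    proof (intro exI[of _ \<delta>] conjI \<delta> ballI impI)
      fix h :: real assume h: "h \<noteq> 0 \<and> dist h 0 < \<delta>"
      hence "norm (?G h - ?G 0 - h *\<^sub>R ?D) \<le> h\<^sup>2 * (K * I)" by (intro est) auto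
      thus "norm (norm (?G (0 + h) - ?G 0 - h *\<^sub>R ?D) / norm h) \<le> \<bar>h\<bar> * (K * I)"
        using h by (simp add: field_simps power2_eq_square)
    qed
    show "(\<lambda>h. norm (?G (0 + h) - ?G 0 - h *\<^sub>R ?D) / norm h) \<midarrow>0\<rightarrow> 0"
      by (rule Lim_null_comparison[OF ev lim])
  qed
qed

text \<open>Moving all three parameters linearly in \<open>x\<close> multiplies the kernel by an exponential that is linear
in \<open>x\<close>. Both the parameter derivatives and the integration over \<open>s\<close> rest on this.\<close>

lemma euler_ker_shift:
  "euler_ker (A + p * x) (C + q * x) (w + x *\<^sub>R y) t
     = euler_ker A C w t * exp (of_real x * (y * of_real t + of_real (p * ln t + q * ln (1 - t))))"
proof (cases "0 < t \<and> t < 1")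
  case True
  have "beta_ker (A + p * x) (C + q * x) t = beta_ker A C t * exp (x * (p * ln t + q * ln (1 - t)))"
    using True by (simp add: beta_ker_def powr_def mult_exp_exp algebra_simps)
  thus ?thesis
    by (simp add: euler_ker_def exp_of_real[symmetric] scaleR_conv_of_real algebra_simps exp_add)
qed (simp add: euler_ker_def beta_ker_def)

text \<open>The exponential moment needed to differentiate under the integral is again an Euler kernel, with
both parameters lowered a little, since \<open>exp (\<epsilon> \<bar>ln t\<bar>)\<close> is the power \<open>t powr - \<epsilon>\<close>.\<close>

lemma euler_ker_param_derivative:
  assumes A: "A > 0" and C: "C > 0"
  shows "((\<lambda>x. \<integral>t. euler_ker (A + p * x) (C + q * x) w t \<partial>lborel) has_vector_derivative
           (\<integral>t. of_real (p * ln t + q * ln (1 - t)) * euler_ker A C w t \<partial>lborel)) (at 0)"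
    and "integrable lborel (\<lambda>t. of_real (p * ln t + q * ln (1 - t)) * euler_ker A C w t)"
proof -
  define \<nu> where "\<nu> = (\<lambda>t. p * ln t + q * ln (1 - t :: real))"
  \<comment> \<open>Small enough that \<open>A - \<epsilon> \<bar>p\<bar>\<close> and \<open>C - \<epsilon> \<bar>q\<bar>\<close> remain positive.\<close>
  define \<epsilon> where "\<epsilon> = min A C / (2 * (\<bar>p\<bar> + \<bar>q\<bar> + 1))"
  have pos: "\<bar>p\<bar> + \<bar>q\<bar> + 1 > 0" by linarith
  have \<epsilon>: "\<epsilon> > 0" using A C pos by (auto simp: \<epsilon>_def intro!: divide_pos_pos)
  have "\<epsilon> * (\<bar>p\<bar> + \<bar>q\<bar> + 1) = min A C / 2" using pos unfolding \<epsilon>_def by (simp add: divide_simps)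
  moreover have "\<epsilon> * \<bar>p\<bar> \<le> \<epsilon> * (\<bar>p\<bar> + \<bar>q\<bar> + 1)" "\<epsilon> * \<bar>q\<bar> \<le> \<epsilon> * (\<bar>p\<bar> + \<bar>q\<bar> + 1)"
    using \<epsilon> by (auto intro!: mult_left_mono)
  ultimately have AC: "A - \<epsilon> * \<bar>p\<bar> > 0" "C - \<epsilon> * \<bar>q\<bar> > 0"
    using A C by (auto simp: min_def split: if_splits)
  have [measurable]: "\<nu> \<in> borel_measurable borel" unfolding \<nu>_def by measurable
  have int: "integrable lborel (\<lambda>t. norm (euler_ker A C w t) * exp (\<epsilon> * \<bar>\<nu> t\<bar>))"
  proof (rule Bochner_Integration.integrable_bound)
    show "integrable lborel (euler_ker (A - \<epsilon> * \<bar>p\<bar>) (C - \<epsilon> * \<bar>q\<bar>) w)"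
      by (rule integrable_euler_ker[OF AC])
    show "AE t in lborel. norm (norm (euler_ker A C w t) * exp (\<epsilon> * \<bar>\<nu> t\<bar>))
            \<le> norm (euler_ker (A - \<epsilon> * \<bar>p\<bar>) (C - \<epsilon> * \<bar>q\<bar>) w t)"
    proof (rule AE_I2)
      fix t :: real
      show "norm (norm (euler_ker A C w t) * exp (\<epsilon> * \<bar>\<nu> t\<bar>))
            \<le> norm (euler_ker (A - \<epsilon> * \<bar>p\<bar>) (C - \<epsilon> * \<bar>q\<bar>) w t)"
      proof (cases "0 < t \<and> t < 1")
        case True
        have "\<bar>\<nu> t\<bar> \<le> \<bar>p\<bar> * \<bar>ln t\<bar> + \<bar>q\<bar> * \<bar>ln (1 - t)\<bar>"
          unfolding \<nu>_def by (metis abs_triangle_ineq abs_mult)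
        also have "\<dots> = - (\<bar>p\<bar> * ln t + \<bar>q\<bar> * ln (1 - t))"
          using True by simp
        finally have "\<epsilon> * \<bar>\<nu> t\<bar> \<le> \<epsilon> * - (\<bar>p\<bar> * ln t + \<bar>q\<bar> * ln (1 - t))"
          using \<epsilon> by (intro mult_left_mono) auto
        hence "norm (euler_ker A C w t) * exp (\<epsilon> * \<bar>\<nu> t\<bar>)
            \<le> norm (euler_ker A C w t) * exp (\<epsilon> * - (\<bar>p\<bar> * ln t + \<bar>q\<bar> * ln (1 - t)))"
          by (intro mult_left_mono) auto
        also have "\<dots> = norm (euler_ker (A + \<bar>p\<bar> * - \<epsilon>) (C + \<bar>q\<bar> * - \<epsilon>) (w + (- \<epsilon>) *\<^sub>R 0) t)"
          unfolding euler_ker_shift norm_mult norm_exp_eq_Re by (simp add: algebra_simps)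
        finally show ?thesis by (simp add: mult.commute)
      qed (auto simp: euler_ker_def beta_ker_def)
    qed
  qed simp
  have eq: "euler_ker (A + p * x) (C + q * x) w t = euler_ker A C w t * of_real (exp (x * \<nu> t))" for x t
    using euler_ker_shift[of A p x C q w 0 t]
    unfolding \<nu>_def exp_of_real[symmetric] of_real_mult by simp
  show "((\<lambda>x. \<integral>t. euler_ker (A + p * x) (C + q * x) w t \<partial>lborel) has_vector_derivative
           (\<integral>t. of_real (p * ln t + q * ln (1 - t)) * euler_ker A C w t \<partial>lborel)) (at 0)"
    unfolding eq \<nu>_def[symmetric]
    using has_vector_derivative_integral_exp(1)[OF _ _ \<epsilon> int] unfolding \<nu>_def by simp
  show "integrable lborel (\<lambda>t. of_real (p * ln t + q * ln (1 - t)) * euler_ker A C w t)"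
    using has_vector_derivative_integral_exp(2)[OF _ _ \<epsilon> int] unfolding \<nu>_def by simp
qed

section \<open>Tail integrals of exponential families\<close>

lemma has_bochner_integral_exp_tail:
  fixes r x :: real
  assumes r: "r > 0"
  shows "has_bochner_integral lborel (\<lambda>s. indicator {x..} s * exp (- r * s)) (exp (- r * x) / r)"
proof (rule has_bochner_integral_nn_integral)
  have lim: "((\<lambda>s. - exp (- r * s) / r) \<longlongrightarrow> - 0 / r) at_top"
    using r by (intro tendsto_intros filterlim_compose[OF exp_at_bot] filterlim_tendsto_neg_mult_at_bot[OF tendsto_const _ filterlim_ident]) auto
  have "(\<integral>\<^sup>+s. ennreal (exp (- r * s)) * indicator {x..} s \<partial>lborel) = ennreal (- 0 / r - (- exp (- r * x) / r))"
    using r by (intro nn_integral_FTC_atLeast[OF _ _ _ lim]) (auto intro!: derivative_eq_intros)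
  thus "(\<integral>\<^sup>+s. ennreal (indicator {x..} s * exp (- r * s)) \<partial>lborel) = ennreal (exp (- r * x) / r)"
    by (simp add: ennreal_mult' ennreal_indicator mult.commute)
qed (use r in auto)

lemma complex_exp_tail_integral:
  fixes m :: complex and x :: real
  assumes m: "Re m > 0"
  shows "set_integrable lborel {x..} (\<lambda>s. - m * exp (- m * of_real s))"
    and "(LINT s:{x..}|lborel. - m * exp (- m * of_real s)) = - exp (- m * of_real x)"
    and "(LINT s:{x..}|lborel. norm (- m * exp (- m * of_real s))) = norm m / Re m * norm (exp (- m * of_real x))"
proof -
  let ?f = "\<lambda>s. - m * exp (- m * complex_of_real s)"
  note tail = has_bochner_integral_exp_tail[OF m, of x, unfolded has_bochner_integral_iff]
  have norm_f: "norm (?f s) = norm m * exp (- Re m * s)" for s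
    by (simp add: norm_mult)
  show int: "set_integrable lborel {x..} ?f"
    unfolding set_integrable_def
    by (rule Bochner_Integration.integrable_bound[OF integrable_mult_right[of "norm m", OF conjunct1[OF tail]]])
       (auto simp: norm_mult indicator_def)
  show "(LINT s:{x..}|lborel. norm (?f s)) = norm m / Re m * norm (exp (- m * of_real x))"
    unfolding norm_f set_lebesgue_integral_def using conjunct2[OF tail]
    by (simp add: mult.left_commute[of "indicator _ _"])
  have lim1: "((\<lambda>y. LINT s:{x..y}|lborel. ?f s) \<longlongrightarrow> (LINT s:{x..}|lborel. ?f s)) at_top"
    by (rule tendsto_set_lebesgue_integral_at_top[OF _ int]) auto
  have fin: "(LINT s:{x..y}|lborel. ?f s) = exp (- m * of_real y) - exp (- m * of_real x)" if "x \<le> y" for y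
    unfolding set_lebesgue_integral_def
  proof (rule integral_FTC_atLeastAtMost[OF that])
    fix s
    have "((\<lambda>u. exp (- m * u)) has_field_derivative ?f s) (at (of_real s))"
      by (auto intro!: derivative_eq_intros)
    thus "((\<lambda>s. exp (- m * of_real s)) has_vector_derivative ?f s) (at s within {x..y})"
      by (rule has_vector_derivative_real_field)
  qed (intro continuous_intros)
  have "((\<lambda>y. exp (- Re m * y)) \<longlongrightarrow> 0) at_top"
    using m by (intro filterlim_compose[OF exp_at_bot] filterlim_tendsto_neg_mult_at_bot[OF tendsto_const _ filterlim_ident]) auto
  hence "((\<lambda>y. exp (- m * complex_of_real y)) \<longlongrightarrow> 0) at_top"
    by (intro tendsto_norm_zero_cancel[of "\<lambda>y. exp (- m * complex_of_real y)"]) simp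
  hence "((\<lambda>y. exp (- m * complex_of_real y) - exp (- m * of_real x)) \<longlongrightarrow> 0 - exp (- m * of_real x)) at_top"
    by (intro tendsto_intros)
  hence lim2: "((\<lambda>y. LINT s:{x..y}|lborel. ?f s) \<longlongrightarrow> 0 - exp (- m * of_real x)) at_top"
    by (rule Lim_transform_eventually) (use fin in \<open>auto simp: eventually_at_top_linorder intro!: exI[of _ x]\<close>)
  show "(LINT s:{x..}|lborel. ?f s) = - exp (- m * of_real x)"
    using tendsto_unique[OF _ lim1 lim2] by simp
qed

text \<open>Integrating first over \<open>s\<close> is explicit for every \<open>t\<close>. The modulus then costs the factor
\<open>\<bar>\<mu>\<bar> / Re \<mu>\<close>, so a bound \<open>K\<close> for that factor yields absolute integrability on the product and
allows Fubini's theorem.\<close>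

lemma tail_integral_of_exponential_family:
  fixes F \<mu> :: "real \<Rightarrow> complex" and x :: real
  assumes [measurable]: "F \<in> borel_measurable borel" "\<mu> \<in> borel_measurable borel"
    and \<mu>: "\<And>t. F t \<noteq> 0 \<Longrightarrow> Re (\<mu> t) > 0" "\<And>t. F t \<noteq> 0 \<Longrightarrow> norm (\<mu> t) \<le> K * Re (\<mu> t)"
    and int: "integrable lborel (\<lambda>t. F t * exp (- \<mu> t * of_real x))"
  defines "h \<equiv> (\<lambda>s. \<integral>t. - \<mu> t * (F t * exp (- \<mu> t * of_real s)) \<partial>lborel)"
  shows "set_integrable lborel {x..} h"
    and "(LINT s:{x..}|lborel. h s) = - (\<integral>t. F t * exp (- \<mu> t * of_real x) \<partial>lborel)"
    and "(LINT s:{x..}|lborel. norm (h s)) \<le> K * (\<integral>t. norm (F t * exp (- \<mu> t * of_real x)) \<partial>lborel)"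
proof -
  define f where "f = (\<lambda>t s. indicator {x..} s *\<^sub>R (- \<mu> t * (F t * exp (- \<mu> t * complex_of_real s))))"
  let ?P = "\<lambda>t. F t * exp (- \<mu> t * of_real x)"
  have f_meas [measurable]: "case_prod f \<in> borel_measurable (lborel \<Otimes>\<^sub>M lborel)"
    unfolding f_def by measurable
  have f_alt: "f t s = F t * (indicator {x..} s *\<^sub>R (- \<mu> t * exp (- \<mu> t * complex_of_real s)))" for t s
    by (simp add: f_def)
  have int_t: "integrable lborel (f t)" for t
    using complex_exp_tail_integral(1)[of "\<mu> t" x] \<mu>(1)[of t]
    unfolding f_alt set_integrable_def by (cases "F t = 0") (auto simp del: mult_scaleR_right intro!: integrable_mult_right)
  have val_t: "(\<integral>s. f t s \<partial>lborel) = - ?P t" for t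
    using complex_exp_tail_integral(2)[of "\<mu> t" x] \<mu>(1)[of t]
    unfolding f_alt set_lebesgue_integral_def by (cases "F t = 0") (auto simp del: mult_scaleR_right)
  have norm_t: "(\<integral>s. norm (f t s) \<partial>lborel) = norm (\<mu> t) / Re (\<mu> t) * norm (?P t)" for t
  proof (cases "F t = 0")
    case False
    have "(\<integral>s. norm (f t s) \<partial>lborel) = (\<integral>s. norm (F t) * (indicator {x..} s *\<^sub>R norm (- \<mu> t * exp (- \<mu> t * complex_of_real s))) \<partial>lborel)"
      unfolding f_alt norm_mult[of "F t"] norm_scaleR by simp
    also have "\<dots> = norm (F t) * (norm (\<mu> t) / Re (\<mu> t) * norm (exp (- \<mu> t * of_real x)))"
      using complex_exp_tail_integral(3)[of "\<mu> t" x] \<mu>(1)[OF False]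
      unfolding set_lebesgue_integral_def by (simp only: integral_mult_right_zero)
    finally show ?thesis by (simp add: norm_mult)
  qed (simp add: f_alt)
  have le_t: "norm (\<mu> t) / Re (\<mu> t) * norm (?P t) \<le> K * norm (?P t)" for t
    using \<mu>[of t] by (cases "F t = 0") (auto intro!: mult_right_mono simp: divide_le_eq)
  have nn_t: "0 \<le> norm (\<mu> t) / Re (\<mu> t) * norm (?P t)" for t
    using \<mu>(1)[of t] by (cases "F t = 0") auto
  have int_norm_t: "integrable lborel (\<lambda>t. norm (\<mu> t) / Re (\<mu> t) * norm (?P t))"
  proof (rule Bochner_Integration.integrable_bound)
    show "integrable lborel (\<lambda>t. K * norm (?P t))"
      by (intro integrable_mult_right integrable_norm int)
    show "AE t in lborel. norm (norm (\<mu> t) / Re (\<mu> t) * norm (?P t)) \<le> norm (K * norm (?P t))"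
      using le_t nn_t unfolding real_norm_def
      by (intro AE_I2) (metis abs_of_nonneg abs_ge_self order_trans)
  qed measurable
  have intf: "integrable (lborel \<Otimes>\<^sub>M lborel) (case_prod f)"
    by (rule lborel_pair.Fubini_integrable[OF f_meas]) (use int_norm_t norm_t int_t in simp_all)
  have h_eq: "(\<integral>t. f t s \<partial>lborel) = indicator {x..} s *\<^sub>R h s" for s
    by (simp add: f_def h_def)
  show "set_integrable lborel {x..} h"
    using lborel_pair.integrable_snd[OF intf] unfolding set_integrable_def h_eq .
  have "(LINT s:{x..}|lborel. h s) = (\<integral>s. \<integral>t. f t s \<partial>lborel \<partial>lborel)"
    by (simp add: set_lebesgue_integral_def h_eq)
  also have "\<dots> = (\<integral>t. \<integral>s. f t s \<partial>lborel \<partial>lborel)"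
    by (rule lborel_pair.Fubini_integral[OF intf])
  finally show "(LINT s:{x..}|lborel. h s) = - (\<integral>t. ?P t \<partial>lborel)"
    by (simp add: val_t)
  have intn: "integrable (lborel \<Otimes>\<^sub>M lborel) (\<lambda>(t, s). norm (f t s))"
    using integrable_norm[OF intf] by (simp add: case_prod_unfold)
  have "(LINT s:{x..}|lborel. norm (h s)) = (\<integral>s. norm (\<integral>t. f t s \<partial>lborel) \<partial>lborel)"
    by (simp add: set_lebesgue_integral_def h_eq)
  also have "\<dots> \<le> (\<integral>s. \<integral>t. norm (f t s) \<partial>lborel \<partial>lborel)"
    by (intro integral_mono integrable_norm lborel_pair.integrable_snd[OF intf] lborel_pair.integrable_snd[OF intn]
        integral_norm_bound)
  also have "\<dots> = (\<integral>t. \<integral>s. norm (f t s) \<partial>lborel \<partial>lborel)"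
    by (rule lborel_pair.Fubini_integral[OF intn])
  also have "\<dots> \<le> (\<integral>t. K * norm (?P t) \<partial>lborel)"
    unfolding norm_t by (intro integral_mono int_norm_t integrable_mult_right integrable_norm int le_t)
  finally show "(LINT s:{x..}|lborel. norm (h s)) \<le> K * (\<integral>t. norm (?P t) \<partial>lborel)"
    by simp
qed

section \<open>Summation by integrals\<close>

text \<open>Between consecutive integers \<open>k\<close> and \<open>k + 1\<close> the integrand is the derivative of
\<open>(u - k) W(u)\<close>, which vanishes at \<open>k\<close> and equals \<open>W(k + 1)\<close> at \<open>k + 1\<close>.\<close>

lemma dfrak_integral_eq_sum:
  fixes W :: "real \<Rightarrow> complex"
  assumes "C1_on_Rplus W"
  shows "set_integrable lborel {0..real n} (dfrak W)"
    and "(LINT u:{0..real n}|lborel. dfrak W u) = (\<Sum>i<n. W (real (Suc i)))"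
proof -
  obtain W' where W': "\<And>x. x \<ge> 0 \<Longrightarrow> (W has_vector_derivative W' x) (at x within {0..})"
    and cont: "continuous_on {0..} W'"
    using assms unfolding C1_on_Rplus_def by blast
  have contW: "continuous_on {0..} W"
    using W' by (intro continuous_on_vector_derivative) auto
  have vd: "vector_derivative W (at x within {0..}) = W' x" if "x \<ge> 0" for x
  proof (rule vector_derivative_within[OF _ W'[OF that]])
    have "at_right x \<le> at x within {0..}" using that by (intro at_le) auto
    thus "at x within {0..} \<noteq> bot"
      using trivial_limit_at_right_real[of x] bot_unique by metis
  qed
  \<comment> \<open>Half-open intervals, because \<open>frac\<close> jumps to 0 at the right end point.\<close>
  have step: "set_integrable lborel {real k..<real (Suc k)} (dfrak W) \<and>
      (LINT u:{real k..<real (Suc k)}|lborel. dfrak W u) = W (real (Suc k))" for k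
  proof -
    let ?a = "real k" and ?b = "real (Suc k)"
    let ?h = "\<lambda>u. W u + (u - real k) *\<^sub>R W' u"
    have conth: "continuous_on {?a..?b} ?h"
      by (intro continuous_intros continuous_on_subset[OF cont] continuous_on_subset[OF contW]) auto
    have int: "set_integrable lborel {?a..?b} ?h"
      by (rule borel_integrable_atLeastAtMost'[OF conth])
    have "(LINT u:{?a..?b}|lborel. ?h u) = (?b - real k) *\<^sub>R W ?b - (?a - real k) *\<^sub>R W ?a"
      unfolding set_lebesgue_integral_def
    proof (rule integral_FTC_atLeastAtMost[OF _ _ conth])
      fix x assume x: "?a \<le> x" "x \<le> ?b"
      have "(W has_vector_derivative W' x) (at x within {?a..?b})"
        using x by (intro has_vector_derivative_within_subset[OF W']) auto
      moreover have "((\<lambda>u. u - real k) has_vector_derivative 1) (at x within {?a..?b})"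
        by (auto intro!: derivative_eq_intros)
      ultimately show "((\<lambda>u. (u - real k) *\<^sub>R W u) has_vector_derivative ?h x) (at x within {?a..?b})"
        by (auto intro!: derivative_eq_intros simp: has_real_derivative_iff_has_vector_derivative)
    qed simp
    hence val: "(LINT u:{?a..?b}|lborel. ?h u) = W ?b" by simp
    have eq: "dfrak W u = ?h u" if "u \<in> {?a..<?b}" for u
    proof -
      have "frac u = u - real k"
        using that by (subst frac_unique_iff) (auto intro: Ints_of_nat)
      thus ?thesis using that vd[of u] by (simp add: dfrak_def)
    qed
    have "set_integrable lborel {?a..<?b} ?h"
      by (rule set_integrable_subset[OF int]) auto
    moreover have "(LINT u:{?a..<?b}|lborel. ?h u) = (LINT u:{?a..?b}|lborel. ?h u)"
      by (rule set_integral_discrete_difference[where X = "{?b}"]) auto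
    moreover have "set_integrable lborel {?a..<?b} (dfrak W) = set_integrable lborel {?a..<?b} ?h"
      by (intro set_integrable_cong refl eq)
    moreover have "(LINT u:{?a..<?b}|lborel. dfrak W u) = (LINT u:{?a..<?b}|lborel. ?h u)"
      by (intro set_lebesgue_integral_cong) (auto simp: eq)
    ultimately show ?thesis using val by simp
  qed
  have "set_integrable lborel {0..<real n} (dfrak W) \<and>
      (LINT u:{0..<real n}|lborel. dfrak W u) = (\<Sum>i<n. W (real (Suc i)))"
  proof (induction n)
    case (Suc n)
    have eq: "{0..<real (Suc n)} = {0..<real n} \<union> {real n..<real (Suc n)}" by auto
    show ?case unfolding eq using Suc step[of n]
      by (subst set_integral_Un) (auto intro!: set_integrable_Un)
  qed (auto simp: set_integrable_def set_lebesgue_integral_def)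
  moreover have "set_integrable lborel {0..real n} (dfrak W) = set_integrable lborel {0..<real n} (dfrak W)"
    by (rule set_integrable_discrete_difference[where X = "{real n}"]) auto
  moreover have "(LINT u:{0..real n}|lborel. dfrak W u) = (LINT u:{0..<real n}|lborel. dfrak W u)"
    by (rule set_integral_discrete_difference[where X = "{real n}"]) auto
  ultimately show "set_integrable lborel {0..real n} (dfrak W)"
    and "(LINT u:{0..real n}|lborel. dfrak W u) = (\<Sum>i<n. W (real (Suc i)))" by simp_all
qed

lemma C1_gamma_weight:
  assumes \<kappa>: "C1_on_Rplus \<kappa>" and ab: "0 < a" "a < b" and \<alpha>\<beta>: "0 < \<alpha>" "\<alpha> \<le> \<beta>"
  shows "C1_on_Rplus (gamma_weight \<kappa> \<alpha> \<beta> a b)"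
proof -
  obtain \<kappa>' where \<kappa>': "\<And>x. x \<ge> 0 \<Longrightarrow> (\<kappa> has_vector_derivative \<kappa>' x) (at x within {0..})"
    and cont: "continuous_on {0..} \<kappa>'"
    using \<kappa> unfolding C1_on_Rplus_def by blast
  have cont\<kappa>: "continuous_on {0..} \<kappa>"
    using \<kappa>' by (intro continuous_on_vector_derivative) auto
  define g where "g = (\<lambda>u. Gamma (b + \<beta> * u) / (Gamma (b - a + (\<beta> - \<alpha>) * u) * Gamma (a + \<alpha> * u)))"
  define l where "l = (\<lambda>u. \<beta> * Digamma (b + \<beta> * u) - (\<beta> - \<alpha>) * Digamma (b - a + (\<beta> - \<alpha>) * u)
                          - \<alpha> * Digamma (a + \<alpha> * u))"
  have pos: "b + \<beta> * u > 0" "b - a + (\<beta> - \<alpha>) * u > 0" "a + \<alpha> * u > 0" if "u \<ge> 0" for u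
    using that ab \<alpha>\<beta> by (auto intro!: add_pos_nonneg)
  have notin: "b + \<beta> * u \<notin> \<int>\<^sub>\<le>\<^sub>0" "b - a + (\<beta> - \<alpha>) * u \<notin> \<int>\<^sub>\<le>\<^sub>0" "a + \<alpha> * u \<notin> \<int>\<^sub>\<le>\<^sub>0" if "u \<ge> 0" for u
    using pos[OF that] by (auto elim!: nonpos_Ints_cases)
  have Gpos: "Gamma (b + \<beta> * u) > 0" "Gamma (b - a + (\<beta> - \<alpha>) * u) > 0" "Gamma (a + \<alpha> * u) > 0" if "u \<ge> 0" for u
    using pos[OF that] by auto
  have dg: "(g has_real_derivative g u * l u) (at u within {0..})" if u: "u \<ge> 0" for u
    unfolding g_def l_def using notin[OF u] Gpos[OF u]
    by (auto intro!: derivative_eq_intros simp: divide_simps) (simp add: algebra_simps)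
  have contg: "continuous_on {0..} g"
    using dg by (intro DERIV_continuous_on) auto
  have contl: "continuous_on {0..} l"
  proof -
    have Dig: "continuous_on {0..} (\<lambda>u. Digamma (f u))"
      if "continuous_on {0..} f" "\<And>u. u \<ge> 0 \<Longrightarrow> f u \<notin> \<int>\<^sub>\<le>\<^sub>0" for f :: "real \<Rightarrow> real"
      by (rule continuous_on_compose2[OF continuous_on_Polygamma[of "- \<int>\<^sub>\<le>\<^sub>0"] that(1)]) (use that(2) in auto)
    show ?thesis
      unfolding l_def by (intro continuous_intros Dig notin) auto
  qed
  let ?W' = "\<lambda>u. \<kappa> u * of_real (g u * l u) + \<kappa>' u * of_real (g u)"
  have "((\<lambda>u. \<kappa> u * of_real (g u)) has_vector_derivative ?W' u) (at u within {0..})" if u: "u \<ge> 0" for u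
    by (intro has_vector_derivative_mult \<kappa>' u has_vector_derivative_of_real dg)
  moreover have "continuous_on {0..} ?W'"
    by (intro continuous_intros cont cont\<kappa> contg contl)
  moreover have "gamma_weight \<kappa> \<alpha> \<beta> a b = (\<lambda>u. \<kappa> u * of_real (g u))"
    unfolding gamma_weight_def g_def by (rule refl)
  ultimately show ?thesis unfolding C1_on_Rplus_def by (intro exI[of _ ?W']) simp
qed

text \<open>Partial summation with tail integrals in place of differences: \<open>h s\<close> is counted by the \<open>n\<close>-th tail
exactly when \<open>Suc n \<le> s\<close>.\<close>

lemma partial_summation_integral:
  fixes W :: "nat \<Rightarrow> complex" and h :: "real \<Rightarrow> complex"
  assumes int: "\<And>n. set_integrable lborel {real (Suc n)..} h"
    and sum: "summable (\<lambda>n. norm (W (Suc n)) * (LINT s:{real (Suc n)..}|lborel. norm (h s)))"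
  shows "set_integrable lborel {0<..} (\<lambda>s. (\<Sum>i<nat \<lfloor>s\<rfloor>. W (Suc i)) * h s)"
    and "(\<lambda>n. W (Suc n) * (LINT s:{real (Suc n)..}|lborel. h s)) sums
           (LINT s:{0<..}|lborel. (\<Sum>i<nat \<lfloor>s\<rfloor>. W (Suc i)) * h s)"
proof -
  define f where "f = (\<lambda>n s. W (Suc n) * (indicator {real (Suc n)..} s *\<^sub>R h s))"
  have intf: "integrable lborel (f n)" for n
    unfolding f_def by (intro integrable_mult_right int[unfolded set_integrable_def])
  have vanish: "f n s = 0" if "n \<notin> {..<nat \<lfloor>s\<rfloor>}" for n s
    using that by (auto simp: f_def indicator_def) linarith
  have norm_f: "(\<integral>s. norm (f n s) \<partial>lborel) = norm (W (Suc n)) * (LINT s:{real (Suc n)..}|lborel. norm (h s))" for n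
    by (simp add: f_def norm_mult set_lebesgue_integral_def mult.left_commute[of "indicator _ _"])
  have s1: "AE s in lborel. summable (\<lambda>n. norm (f n s))"
    using vanish by (intro AE_I2 summable_finite[of "{..<nat \<lfloor>_\<rfloor>}"]) auto
  have s2: "summable (\<lambda>n. \<integral>s. norm (f n s) \<partial>lborel)"
    unfolding norm_f by (rule sum)
  have "(\<Sum>n. f n s) = (\<Sum>n<nat \<lfloor>s\<rfloor>. f n s)" for s
    using vanish by (intro suminf_finite) auto
  also have "(\<Sum>n<nat \<lfloor>s\<rfloor>. f n s) = (\<Sum>n<nat \<lfloor>s\<rfloor>. W (Suc n) * h s)" for s
    by (intro sum.cong) (auto simp: f_def indicator_def, linarith)
  also have "(\<Sum>n<nat \<lfloor>s\<rfloor>. W (Suc n) * h s) = indicator {0<..} s *\<^sub>R ((\<Sum>i<nat \<lfloor>s\<rfloor>. W (Suc i)) * h s)" for s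
    by (auto simp: sum_distrib_right indicator_def)
  finally have eq: "(\<Sum>n. f n s) = indicator {0<..} s *\<^sub>R ((\<Sum>i<nat \<lfloor>s\<rfloor>. W (Suc i)) * h s)" for s .
  show "set_integrable lborel {0<..} (\<lambda>s. (\<Sum>i<nat \<lfloor>s\<rfloor>. W (Suc i)) * h s)"
    unfolding set_integrable_def eq[symmetric] by (rule integrable_suminf[OF intf s1 s2])
  have "(\<lambda>n. \<integral>s. f n s \<partial>lborel) sums (\<integral>s. (\<Sum>n. f n s) \<partial>lborel)"
    by (rule sums_integral[OF intf s1 s2])
  thus "(\<lambda>n. W (Suc n) * (LINT s:{real (Suc n)..}|lborel. h s)) sums
           (LINT s:{0<..}|lborel. (\<Sum>i<nat \<lfloor>s\<rfloor>. W (Suc i)) * h s)"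
    unfolding eq by (simp add: f_def set_lebesgue_integral_def del: mult_scaleR_right)
qed

section \<open>The kernel of the integral representation\<close>

lemma Gamma_bold_eq_Beta:
  "Gamma_bold 0 \<alpha> \<beta> s a b = Beta (a + \<alpha> * s) (b - a + (\<beta> - \<alpha>) * s)"
  "Gamma_bold 1 \<alpha> \<beta> s a b = Beta (a + \<alpha> * s + 1) (b - a + (\<beta> - \<alpha>) * s)"
  by (simp_all add: Gamma_bold_def Beta_def algebra_simps)

lemma Gamma_bold_times_M_star:
  assumes "a + \<alpha> * s > 0" "b - a + (\<beta> - \<alpha>) * s > 0"
  shows "of_real (Gamma_bold 0 \<alpha> \<beta> s a b) * M_star \<alpha> \<beta> \<zeta> z s a b
     = (\<integral>t. euler_ker (a + \<alpha> * s) (b - a + (\<beta> - \<alpha>) * s) (z * of_real (1 + \<zeta> * s)) t \<partial>lborel)"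
  using Euler_integral_kummer[OF assms, of "z * of_real (1 + \<zeta> * s)"]
  unfolding Gamma_bold_eq_Beta(1) M_star_def by (simp add: algebra_simps)

lemma M_star_derivative_a:
  assumes "a + \<alpha> * s > 0" "b + \<beta> * s > 0"
  shows "((\<lambda>a'. M_star \<alpha> \<beta> \<zeta> z s a' b) has_vector_derivative
           (z * of_real (1 + \<zeta> * s) / of_real (b + \<beta> * s) *
            kampe_de_feriet [of_real (a + \<alpha> * s + 1)] [1] [1, of_real (a + \<alpha> * s)]
                            [2, of_real (b + \<beta> * s + 1)] [] [of_real (a + \<alpha> * s + 1)]
                            (z * of_real (1 + \<zeta> * s)) (z * of_real (1 + \<zeta> * s)))) (at a)"
proof -
  have "((\<lambda>a'. a' + \<alpha> * s) has_vector_derivative 1) (at a)"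
    by (auto intro!: derivative_eq_intros)
  from vector_diff_chain_at[OF this vector_derivative_kummer_M_a[OF assms]]
  show ?thesis by (simp add: M_star_def o_def)
qed

lemma M_star_derivative_b:
  assumes "a + \<alpha> * s > 0" "b + \<beta> * s > 0"
  shows "((\<lambda>b'. M_star \<alpha> \<beta> \<zeta> z s a b') has_vector_derivative
           (- (of_real (a + \<alpha> * s) * (z * of_real (1 + \<zeta> * s)) / (of_real (b + \<beta> * s))\<^sup>2) *
            kampe_de_feriet [of_real (a + \<alpha> * s + 1)] [1] [1, of_real (b + \<beta> * s)]
                            [2, of_real (b + \<beta> * s + 1)] [] [of_real (b + \<beta> * s + 1)]
                            (z * of_real (1 + \<zeta> * s)) (z * of_real (1 + \<zeta> * s)))) (at b)"
proof -
  have "((\<lambda>b'. b' + \<beta> * s) has_vector_derivative 1) (at b)"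
    by (auto intro!: derivative_eq_intros)
  from vector_diff_chain_at[OF this vector_derivative_kummer_M_b[OF assms]]
  show ?thesis by (simp add: M_star_def o_def)
qed

text \<open>The product of \<open>g\<close> and \<open>m\<close> is an Euler integral near \<open>x\<close>, hence its derivative, computed by the
product rule, is also the logarithmic moment obtained under the integral sign. The two factors are
assumed differentiable separately, because the kernel of the theorem mentions
their derivatives one by one.\<close>

lemma product_derivative_eq_log_moment:
  fixes g :: "real \<Rightarrow> real" and m :: "real \<Rightarrow> complex"
  assumes AC: "A > 0" "C > 0"
    and g: "g differentiable (at x)" and m: "m differentiable (at x)"
    and eq: "\<And>y. A + p * y > 0 \<Longrightarrow> C + q * y > 0 \<Longrightarrow>
      of_real (g (x + y)) * m (x + y) = (\<integral>t. euler_ker (A + p * y) (C + q * y) w t \<partial>lborel)"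
  shows "of_real (deriv g x) * m x + of_real (g x) * vector_derivative m (at x)
    = (\<integral>t. of_real (p * ln t + q * ln (1 - t)) * euler_ker A C w t \<partial>lborel)"
proof -
  have "(g has_real_derivative deriv g x) (at x)"
    using g by (simp add: DERIV_deriv_iff_real_differentiable)
  hence "((\<lambda>y. complex_of_real (g y)) has_vector_derivative of_real (deriv g x)) (at x)"
    by (intro has_vector_derivative_of_real)
  moreover have "(m has_vector_derivative vector_derivative m (at x)) (at x)"
    using m by (simp add: vector_derivative_works)
  ultimately have prod: "((\<lambda>y. of_real (g y) * m y) has_vector_derivative
      (of_real (g x) * vector_derivative m (at x) + of_real (deriv g x) * m x)) (at x)"
    by (rule has_vector_derivative_mult)
  have "((\<lambda>y. x + y) has_vector_derivative 1) (at 0)"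
    by (auto intro!: derivative_eq_intros)
  from vector_diff_chain_at[OF this] prod
  have prod0: "((\<lambda>y. of_real (g (x + y)) * m (x + y)) has_vector_derivative
      (of_real (g x) * vector_derivative m (at x) + of_real (deriv g x) * m x)) (at 0)"
    by (fastforce simp: o_def)
  \<comment> \<open>The identity is needed only near \<open>y = 0\<close>, where both shifted parameters stay positive.\<close>
  define U where "U = {y. A + p * y > 0} \<inter> {y. C + q * y > 0}"
  have "open U" unfolding U_def by (intro open_Int open_Collect_less continuous_intros)
  moreover have "0 \<in> U" using AC by (simp add: U_def)
  ultimately have "((\<lambda>y. of_real (g (x + y)) * m (x + y)) has_vector_derivative
     (\<integral>t. of_real (p * ln t + q * ln (1 - t)) * euler_ker A C w t \<partial>lborel)) (at 0)"
    by (rule has_vector_derivative_transform_within_open[OF euler_ker_param_derivative(1)[OF AC, of p q w]])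
       (simp add: eq U_def)
  from vector_derivative_unique_at[OF prod0 this] show ?thesis by (simp add: add.commute)
qed

text \<open>Increasing \<open>a\<close> moves the exponents of \<open>t\<close> and \<open>1 - t\<close> in opposite directions and contributes
\<open>ln t - ln (1 - t)\<close>; increasing \<open>b\<close> contributes \<open>ln (1 - t)\<close>. Weighted with \<open>\<alpha>\<close> and \<open>\<beta>\<close> they add
up to \<open>\<alpha> ln t + (\<beta> - \<alpha>) ln (1 - t)\<close>. The derivative of \<open>exp (w(s) t)\<close> contributes
\<open>\<zeta> z t\<close>, and the factor \<open>t\<close> raises the parameters of Kummer's function by one.\<close>

lemma kk_kernel_eq_log_moment:
  fixes a b \<alpha> \<beta> \<zeta> s :: real and z :: complex
  assumes A: "a + \<alpha> * s > 0" and C: "b - a + (\<beta> - \<alpha>) * s > 0"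
  defines "E \<equiv> euler_ker (a + \<alpha> * s) (b - a + (\<beta> - \<alpha>) * s) (z * of_real (1 + \<zeta> * s))"
  shows "kk_kernel a b \<alpha> \<beta> \<zeta> z s =
     (\<integral>t. (of_real \<zeta> * z * of_real t + of_real (\<alpha> * ln t + (\<beta> - \<alpha>) * ln (1 - t))) * E t \<partial>lborel)"
proof -
  let ?A = "a + \<alpha> * s" and ?C = "b - a + (\<beta> - \<alpha>) * s" and ?w = "z * of_real (1 + \<zeta> * s)"
  have ABsum: "?A + ?C = b + \<beta> * s" by (simp add: algebra_simps)
  have B: "b + \<beta> * s > 0" using A C unfolding ABsum[symmetric] by linarith
  have notin: "?A \<notin> \<int>\<^sub>\<le>\<^sub>0" "?C \<notin> \<int>\<^sub>\<le>\<^sub>0" "b + \<beta> * s \<notin> \<int>\<^sub>\<le>\<^sub>0"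
    using A B C by (auto elim!: nonpos_Ints_cases)
  have Gpos: "Gamma (b + \<beta> * s) \<noteq> 0" using Gamma_real_pos[OF B] by linarith
  have diff_a: "(\<lambda>a'. Gamma_bold 0 \<alpha> \<beta> s a' b) differentiable (at a)"
    and diff_b: "(\<lambda>b'. Gamma_bold 0 \<alpha> \<beta> s a b') differentiable (at b)"
    unfolding Gamma_bold_def real_differentiable_def using notin Gpos
    by (auto intro!: exI derivative_eq_intros)
  have mdiff_a: "(\<lambda>a'. M_star \<alpha> \<beta> \<zeta> z s a' b) differentiable (at a)"
    using M_star_derivative_a[OF A B] by (rule differentiableI_vector)
  have mdiff_b: "(\<lambda>b'. M_star \<alpha> \<beta> \<zeta> z s a b') differentiable (at b)"
    using M_star_derivative_b[OF A B] by (rule differentiableI_vector)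
  let ?Ia = "\<integral>t. of_real (1 * ln t + (-1) * ln (1 - t)) * E t \<partial>lborel"
  let ?Ib = "\<integral>t. of_real (0 * ln t + 1 * ln (1 - t)) * E t \<partial>lborel"
  let ?I0 = "\<integral>t. euler_ker (?A + 1) ?C ?w t \<partial>lborel"
  have Ia: "of_real (deriv (\<lambda>a'. Gamma_bold 0 \<alpha> \<beta> s a' b) a) * M_star \<alpha> \<beta> \<zeta> z s a b
      + of_real (Gamma_bold 0 \<alpha> \<beta> s a b) * vector_derivative (\<lambda>a'. M_star \<alpha> \<beta> \<zeta> z s a' b) (at a) = ?Ia"
    unfolding E_def
  proof (rule product_derivative_eq_log_moment[OF A C diff_a mdiff_a])
    fix y assume "?A + 1 * y > 0" "?C + (-1) * y > 0"
    thus "of_real (Gamma_bold 0 \<alpha> \<beta> s (a + y) b) * M_star \<alpha> \<beta> \<zeta> z s (a + y) b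
        = (\<integral>t. euler_ker (?A + 1 * y) (?C + (-1) * y) ?w t \<partial>lborel)"
      by (subst Gamma_bold_times_M_star) (auto simp: algebra_simps)
  qed
  have Ib: "of_real (deriv (\<lambda>b'. Gamma_bold 0 \<alpha> \<beta> s a b') b) * M_star \<alpha> \<beta> \<zeta> z s a b
      + of_real (Gamma_bold 0 \<alpha> \<beta> s a b) * vector_derivative (\<lambda>b'. M_star \<alpha> \<beta> \<zeta> z s a b') (at b) = ?Ib"
    unfolding E_def
  proof (rule product_derivative_eq_log_moment[OF A C diff_b mdiff_b])
    fix y assume "?A + 0 * y > 0" "?C + 1 * y > 0"
    thus "of_real (Gamma_bold 0 \<alpha> \<beta> s a (b + y)) * M_star \<alpha> \<beta> \<zeta> z s a (b + y)
        = (\<integral>t. euler_ker (?A + 0 * y) (?C + 1 * y) ?w t \<partial>lborel)"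
      by (subst Gamma_bold_times_M_star) (auto simp: algebra_simps)
  qed
  have A1: "?A + 1 > 0" using A by linarith
  from Euler_integral_kummer[OF A1 C, of ?w]
  have I0: "of_real (Gamma_bold 1 \<alpha> \<beta> s a b) * kummer_M (of_real (a + \<alpha> * s + 1)) (of_real (b + \<beta> * s + 1)) ?w = ?I0"
    unfolding Gamma_bold_eq_Beta(2) by (simp add: algebra_simps)
  have e0: "euler_ker (?A + 1) ?C ?w t = of_real t * E t" for t
    using beta_ker_times_power[of ?A ?C t 1] by (simp add: E_def euler_ker_def mult.commute flip: of_real_mult)
  have i0: "integrable lborel (\<lambda>t. of_real \<zeta> * z * (of_real t * E t))"
    unfolding e0[symmetric] using integrable_euler_ker[OF A1 C] by (rule integrable_mult_right)
  have ia: "integrable lborel (\<lambda>t. of_real \<alpha> * (of_real (1 * ln t + (-1) * ln (1 - t)) * E t))"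
    unfolding E_def by (intro integrable_mult_right euler_ker_param_derivative(2) A C)
  have ib: "integrable lborel (\<lambda>t. of_real \<beta> * (of_real (0 * ln t + 1 * ln (1 - t)) * E t))"
    unfolding E_def by (intro integrable_mult_right euler_ker_param_derivative(2) A C)
  have "(\<integral>t. (of_real \<zeta> * z * of_real t + of_real (\<alpha> * ln t + (\<beta> - \<alpha>) * ln (1 - t))) * E t \<partial>lborel)
     = (\<integral>t. of_real \<zeta> * z * (of_real t * E t) + (of_real \<beta> * (of_real (0 * ln t + 1 * ln (1 - t)) * E t)
          + of_real \<alpha> * (of_real (1 * ln t + (-1) * ln (1 - t)) * E t)) \<partial>lborel)"
    by (intro Bochner_Integration.integral_cong refl) (simp add: algebra_simps)
  also have "\<dots> = of_real \<zeta> * z * ?I0 + (of_real \<beta> * ?Ib + of_real \<alpha> * ?Ia)"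
    unfolding Bochner_Integration.integral_add[OF i0 Bochner_Integration.integrable_add[OF ib ia]]
      Bochner_Integration.integral_add[OF ib ia] integral_mult_right_zero e0 ..
  also have "\<dots> = kk_kernel a b \<alpha> \<beta> \<zeta> z s"
    unfolding I0[symmetric] Ia[symmetric] Ib[symmetric] kk_kernel_def by (simp add: algebra_simps)
  finally show ?thesis by simp
qed

section \<open>The Kapteyn--Kummer series\<close>

text \<open>The logarithm of the limit of the roots lies below a negative number, so the limit itself is below 1
and the root test applies. A vanishing limit has to be treated apart, since there \<open>log_ext\<close> is
\<open>-\<infinity>\<close> and \<open>ln\<close> is of no use.\<close>

lemma summable_norm_of_R_region:
  assumes "z \<in> R_region k \<zeta>"
  shows "summable (\<lambda>n. norm (k n))" and "\<zeta> * Re z < 0"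
proof -
  let ?r = "\<lambda>n. root n (cmod (k n))"
  define L where "L = lim ?r"
  have conv: "convergent ?r" and lt: "log_ext L < ereal (\<zeta> * Re z)" and neg: "\<zeta> * Re z < 0"
    using assms by (auto simp: R_region_def L_def)
  show "\<zeta> * Re z < 0" by fact
  have lim: "?r \<longlonglongrightarrow> L" using conv by (simp add: convergent_LIMSEQ_iff L_def)
  have "L \<ge> 0" by (rule LIMSEQ_le_const[OF lim]) (auto simp: real_root_ge_zero)
  have "L < 1"
  proof (cases "L = 0")
    case False
    hence "ln L < 0" using lt neg by (simp add: log_ext_def)
    thus ?thesis using False \<open>L \<ge> 0\<close> by simp
  qed simp
  have "(\<lambda>n. ereal (root n (norm (norm (k n))))) \<longlonglongrightarrow> ereal L" using lim by simp
  hence "limsup (\<lambda>n. ereal (root n (norm (norm (k n))))) = ereal L"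
    by (intro lim_imp_Limsup) auto
  thus "summable (\<lambda>n. norm (k n))"
    using \<open>L < 1\<close> by (intro root_test_convergence') simp
qed

text \<open>The Euler kernel along \<open>s\<close> is an exponential family with rate \<open>\<mu>\<close>. Its real part is
\<open>- \<zeta> Re z t\<close> plus a positive logarithmic part \<open>l\<close>, while \<open>\<bar>\<mu>\<bar>\<close> is at most \<open>\<bar>\<zeta> z\<bar> t + l\<close>; comparing
these term by term yields the constant. It is uniform in \<open>x\<close> because \<open>Re (z (1 + \<zeta> x)) \<le> \<bar>Re z\<bar>\<close>.\<close>

lemma kk_kernel_tail:
  assumes ab: "0 < a" "a < b" and \<alpha>\<beta>: "0 < \<alpha>" "\<alpha> \<le> \<beta>" and neg: "\<zeta> * Re z < 0"
  shows "\<exists>K\<ge>0. \<forall>x\<ge>0.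
     set_integrable lborel {x..} (kk_kernel a b \<alpha> \<beta> \<zeta> z) \<and>
     (LINT s:{x..}|lborel. kk_kernel a b \<alpha> \<beta> \<zeta> z s) =
        - (of_real (Gamma_bold 0 \<alpha> \<beta> x a b) * M_star \<alpha> \<beta> \<zeta> z x a b) \<and>
     norm (of_real (Gamma_bold 0 \<alpha> \<beta> x a b) * M_star \<alpha> \<beta> \<zeta> z x a b) \<le> K * Gamma_bold 0 \<alpha> \<beta> x a b \<and>
     (LINT s:{x..}|lborel. norm (kk_kernel a b \<alpha> \<beta> \<zeta> z s)) \<le> K * Gamma_bold 0 \<alpha> \<beta> x a b"
proof -
  define A where "A = (\<lambda>s. a + \<alpha> * s)"
  define C where "C = (\<lambda>s. b - a + (\<beta> - \<alpha>) * s)"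
  define w where "w = (\<lambda>s. z * complex_of_real (1 + \<zeta> * s))"
  define F where "F = euler_ker a (b - a) z"
  define \<mu> where "\<mu> = (\<lambda>t. - (of_real \<zeta> * z * of_real t + complex_of_real (\<alpha> * ln t + (\<beta> - \<alpha>) * ln (1 - t))))"
  define K where "K = max 1 (norm (of_real \<zeta> * z) / - (\<zeta> * Re z))"
  have pos: "A s > 0" "C s > 0" if "s \<ge> 0" for s
    using that ab \<alpha>\<beta> by (auto simp: A_def C_def intro!: add_pos_nonneg)
  have F_shift: "F t * exp (- \<mu> t * of_real s) = euler_ker (A s) (C s) (w s) t" for t s
    using euler_ker_shift[of a \<alpha> s "b - a" "\<beta> - \<alpha>" z "of_real \<zeta> * z" t]
    by (simp add: F_def \<mu>_def A_def C_def w_def algebra_simps scaleR_conv_of_real)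
  have K: "K \<ge> 1" "norm (of_real \<zeta> * z) \<le> K * - (\<zeta> * Re z)"
  proof -
    show "K \<ge> 1" by (simp add: K_def)
    have "norm (of_real \<zeta> * z) = norm (of_real \<zeta> * z) / - (\<zeta> * Re z) * - (\<zeta> * Re z)"
      using neg by (intro nonzero_divide_eq_eq[THEN iffD1, OF _ refl]) linarith
    also have "\<dots> \<le> K * - (\<zeta> * Re z)"
      unfolding K_def using neg by (intro mult_right_mono) auto
    finally show "norm (of_real \<zeta> * z) \<le> K * - (\<zeta> * Re z)" .
  qed
  have \<mu>: "Re (\<mu> t) > 0" "norm (\<mu> t) \<le> K * Re (\<mu> t)" if "F t \<noteq> 0" for t
  proof -
    have t: "0 < t" "t < 1" using that by (auto simp: F_def euler_ker_def beta_ker_def indicator_def split: if_splits)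
    define l where "l = - (\<alpha> * ln t + (\<beta> - \<alpha>) * ln (1 - t))"
    have l: "l > 0"
    proof -
      have "\<alpha> * ln t < 0" using t \<alpha>\<beta> by (intro mult_pos_neg) auto
      moreover have "(\<beta> - \<alpha>) * ln (1 - t) \<le> 0" using t \<alpha>\<beta> by (intro mult_nonneg_nonpos) auto
      ultimately show ?thesis by (simp add: l_def)
    qed
    have \<mu>_eq: "\<mu> t = - (of_real \<zeta> * z) * of_real t + of_real l"
      by (simp add: \<mu>_def l_def)
    have Re_\<mu>: "Re (\<mu> t) = - (\<zeta> * Re z) * t + l" by (simp add: \<mu>_eq)
    have "- (\<zeta> * Re z) * t > 0" using neg t by (intro mult_pos_pos) auto
    thus "Re (\<mu> t) > 0" using l Re_\<mu> by linarith
    have "norm (\<mu> t) \<le> norm (of_real \<zeta> * z) * t + l"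
      unfolding \<mu>_eq using t l by (intro order_trans[OF norm_triangle_ineq]) (simp add: norm_mult)
    also have "\<dots> \<le> (K * - (\<zeta> * Re z)) * t + K * l"
      using K t l by (intro add_mono mult_right_mono) auto
    also have "\<dots> = K * Re (\<mu> t)" by (simp add: Re_\<mu> algebra_simps)
    finally show "norm (\<mu> t) \<le> K * Re (\<mu> t)" .
  qed
  have meas: "F \<in> borel_measurable borel" "\<mu> \<in> borel_measurable borel"
    unfolding F_def \<mu>_def by measurable
  define h where "h = (\<lambda>s. \<integral>t. - \<mu> t * (F t * exp (- \<mu> t * complex_of_real s)) \<partial>lborel)"
  have h: "kk_kernel a b \<alpha> \<beta> \<zeta> z s = h s" if "s \<ge> 0" for s
    using kk_kernel_eq_log_moment[of a \<alpha> s b \<beta> \<zeta> z] pos[OF that]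
    unfolding h_def F_shift unfolding \<mu>_def minus_minus A_def C_def w_def by blast
  let ?c = "\<bar>Re z\<bar>"
  show ?thesis
  proof (intro exI[of _ "K * exp ?c"] conjI allI impI)
    show "0 \<le> K * exp ?c" using K by simp
    fix x :: real assume x: "x \<ge> 0"
    have G: "of_real (Gamma_bold 0 \<alpha> \<beta> x a b) * M_star \<alpha> \<beta> \<zeta> z x a b
       = (\<integral>t. F t * exp (- \<mu> t * of_real x) \<partial>lborel)"
      using Gamma_bold_times_M_star[of a \<alpha> x b \<beta> \<zeta> z] pos[OF x]
      unfolding F_shift by (simp add: A_def C_def w_def)
    have int: "integrable lborel (\<lambda>t. F t * exp (- \<mu> t * of_real x))"
      unfolding F_shift using pos[OF x] by (rule integrable_euler_ker)
    have tail: "set_integrable lborel {x..} h"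
      "(LINT s:{x..}|lborel. h s) = - (\<integral>t. F t * exp (- \<mu> t * of_real x) \<partial>lborel)"
      "(LINT s:{x..}|lborel. norm (h s)) \<le> K * (\<integral>t. norm (F t * exp (- \<mu> t * of_real x)) \<partial>lborel)"
      unfolding h_def by (rule tail_integral_of_exponential_family[OF meas _ _ int]; fact \<mu>)+
    have "\<zeta> * Re z * x \<le> 0" using neg x by (simp add: mult_nonpos_nonneg)
    hence "Re (w x) \<le> ?c" by (simp add: w_def algebra_simps)
    hence norm_le: "(\<integral>t. norm (F t * exp (- \<mu> t * of_real x)) \<partial>lborel) \<le> exp ?c * Gamma_bold 0 \<alpha> \<beta> x a b"
      unfolding F_shift using integral_norm_euler_ker_le[OF pos[OF x], of "w x" ?c]
      by (simp add: Gamma_bold_eq_Beta(1) A_def C_def)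
    have Gb: "Gamma_bold 0 \<alpha> \<beta> x a b \<ge> 0"
      using Beta_pos[OF pos[OF x]] by (simp add: Gamma_bold_eq_Beta(1) A_def C_def)
    show "set_integrable lborel {x..} (kk_kernel a b \<alpha> \<beta> \<zeta> z)"
      using tail(1) x by (subst set_integrable_cong[OF refl refl h]) auto
    show "(LINT s:{x..}|lborel. kk_kernel a b \<alpha> \<beta> \<zeta> z s) =
        - (of_real (Gamma_bold 0 \<alpha> \<beta> x a b) * M_star \<alpha> \<beta> \<zeta> z x a b)"
    proof -
      have "(LINT s:{x..}|lborel. kk_kernel a b \<alpha> \<beta> \<zeta> z s) = (LINT s:{x..}|lborel. h s)"
        using x h by (intro set_lebesgue_integral_cong) auto
      thus ?thesis unfolding G using tail(2) by simp
    qed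
    have "norm (of_real (Gamma_bold 0 \<alpha> \<beta> x a b) * M_star \<alpha> \<beta> \<zeta> z x a b) \<le> exp ?c * Gamma_bold 0 \<alpha> \<beta> x a b"
      unfolding G by (rule order_trans[OF integral_norm_bound norm_le])
    also have "\<dots> \<le> K * (exp ?c * Gamma_bold 0 \<alpha> \<beta> x a b)"
      using mult_right_mono[OF K(1), of "exp ?c * Gamma_bold 0 \<alpha> \<beta> x a b"] Gb by simp
    finally show "norm (of_real (Gamma_bold 0 \<alpha> \<beta> x a b) * M_star \<alpha> \<beta> \<zeta> z x a b) \<le> K * exp ?c * Gamma_bold 0 \<alpha> \<beta> x a b"
      by simp
    have "(LINT s:{x..}|lborel. norm (kk_kernel a b \<alpha> \<beta> \<zeta> z s)) = (LINT s:{x..}|lborel. norm (h s))"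
      using x h by (intro set_lebesgue_integral_cong) auto
    also have "\<dots> \<le> K * (exp ?c * Gamma_bold 0 \<alpha> \<beta> x a b)"
      using tail(3) mult_left_mono[OF norm_le, of K] K(1) by linarith
    finally show "(LINT s:{x..}|lborel. norm (kk_kernel a b \<alpha> \<beta> \<zeta> z s)) \<le> K * exp ?c * Gamma_bold 0 \<alpha> \<beta> x a b"
      by simp
  qed
qed

text \<open>The Gamma quotient in the weight is the reciprocal of the factor \<open>\<Gamma>\<^sub>0\<close> in Euler's integral.\<close>

lemma kk_term_eq_weight:
  assumes ab: "0 < a" "a < b" and \<alpha>\<beta>: "0 < \<alpha>" "\<alpha> \<le> \<beta>" and \<kappa>: "\<kappa> (real n) = k n"
  shows "kk_term k a b \<alpha> \<beta> \<zeta> z n = gamma_weight \<kappa> \<alpha> \<beta> a b (real n) *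
           (of_real (Gamma_bold 0 \<alpha> \<beta> (real n) a b) * M_star \<alpha> \<beta> \<zeta> z (real n) a b)"
    and "norm (gamma_weight \<kappa> \<alpha> \<beta> a b (real n)) * Gamma_bold 0 \<alpha> \<beta> (real n) a b = norm (k n)"
proof -
  have pos: "a + \<alpha> * real n > 0" "b - a + (\<beta> - \<alpha>) * real n > 0" "b + \<beta> * real n > 0"
    using ab \<alpha>\<beta> by (auto intro!: add_pos_nonneg)
  let ?g = "Gamma (b + \<beta> * real n) / (Gamma (b - a + (\<beta> - \<alpha>) * real n) * Gamma (a + \<alpha> * real n))"
  have g: "?g * Gamma_bold 0 \<alpha> \<beta> (real n) a b = 1" "?g > 0"
    using pos[THEN Gamma_real_pos] by (auto simp: Gamma_bold_def)
  have W: "gamma_weight \<kappa> \<alpha> \<beta> a b (real n) = k n * of_real ?g"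
    by (simp only: gamma_weight_def \<kappa>)
  have "gamma_weight \<kappa> \<alpha> \<beta> a b (real n) * of_real (Gamma_bold 0 \<alpha> \<beta> (real n) a b)
      = k n * of_real (?g * Gamma_bold 0 \<alpha> \<beta> (real n) a b)"
    unfolding W by (simp only: of_real_mult mult.assoc)
  hence "gamma_weight \<kappa> \<alpha> \<beta> a b (real n) * of_real (Gamma_bold 0 \<alpha> \<beta> (real n) a b) = k n"
    unfolding g by simp
  thus "kk_term k a b \<alpha> \<beta> \<zeta> z n = gamma_weight \<kappa> \<alpha> \<beta> a b (real n) *
           (of_real (Gamma_bold 0 \<alpha> \<beta> (real n) a b) * M_star \<alpha> \<beta> \<zeta> z (real n) a b)"
    unfolding mult.assoc[symmetric] by (simp add: kk_term_def M_star_def)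
  have "norm (gamma_weight \<kappa> \<alpha> \<beta> a b (real n)) = norm (k n) * ?g"
    unfolding W norm_mult norm_of_real using g(2) by (simp only: abs_of_pos)
  thus "norm (gamma_weight \<kappa> \<alpha> \<beta> a b (real n)) * Gamma_bold 0 \<alpha> \<beta> (real n) a b = norm (k n)"
    using g(1) by (simp only: mult.assoc mult_1_right)
qed

theorem theorem2:
  fixes \<kappa> :: "real \<Rightarrow> complex" and k :: "nat \<Rightarrow> complex"
    and a b \<alpha> \<beta> \<zeta> :: real and z :: complex
  assumes "C1_on_Rplus \<kappa>"
    and "\<And>n. \<kappa> (real n) = k n"
    and "0 < a" and "a < b" and "0 < \<alpha>" and "\<alpha> \<le> \<beta>"
    and "z \<in> R_region k \<zeta>"
  shows "summable (kk_term k a b \<alpha> \<beta> \<zeta> z)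
    \<and> (\<forall>s>0. set_integrable lborel {0..real_of_int \<lfloor>s\<rfloor>} (\<lambda>u. kk_integrand \<kappa> a b \<alpha> \<beta> \<zeta> z s u))
    \<and> set_integrable lborel {0<..}
        (\<lambda>s. LINT u:{0..real_of_int \<lfloor>s\<rfloor>}|lborel. kk_integrand \<kappa> a b \<alpha> \<beta> \<zeta> z s u)
    \<and> kapteyn_kummer k a b \<alpha> \<beta> \<zeta> z =
        k 0 * kummer_M (of_real a) (of_real b) z
        - (LINT s:{0<..}|lborel. LINT u:{0..real_of_int \<lfloor>s\<rfloor>}|lborel.
             kk_integrand \<kappa> a b \<alpha> \<beta> \<zeta> z s u)
    \<and> (\<forall>s\<ge>0.
        ((\<lambda>a'. M_star \<alpha> \<beta> \<zeta> z s a' b) has_vector_derivative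
           (z * of_real (1 + \<zeta> * s) / of_real (b + \<beta> * s) *
            kampe_de_feriet [of_real (a + \<alpha> * s + 1)] [1] [1, of_real (a + \<alpha> * s)]
                            [2, of_real (b + \<beta> * s + 1)] [] [of_real (a + \<alpha> * s + 1)]
                            (z * of_real (1 + \<zeta> * s)) (z * of_real (1 + \<zeta> * s)))) (at a)
      \<and> ((\<lambda>b'. M_star \<alpha> \<beta> \<zeta> z s a b') has_vector_derivative
           (- (of_real (a + \<alpha> * s) * (z * of_real (1 + \<zeta> * s)) / (of_real (b + \<beta> * s))\<^sup>2) *
            kampe_de_feriet [of_real (a + \<alpha> * s + 1)] [1] [1, of_real (b + \<beta> * s)]
                            [2, of_real (b + \<beta> * s + 1)] [] [of_real (b + \<beta> * s + 1)]
                            (z * of_real (1 + \<zeta> * s)) (z * of_real (1 + \<zeta> * s)))) (at b))"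
proof -
  note ab = \<open>0 < a\<close> \<open>a < b\<close> and \<alpha>\<beta> = \<open>0 < \<alpha>\<close> \<open>\<alpha> \<le> \<beta>\<close> and k = assms(2)
  note k_sum = summable_norm_of_R_region(1)[OF assms(7)]
  define W where "W = gamma_weight \<kappa> \<alpha> \<beta> a b"
  define h where "h = kk_kernel a b \<alpha> \<beta> \<zeta> z"
  define G where "G = (\<lambda>n. of_real (Gamma_bold 0 \<alpha> \<beta> (real n) a b) * M_star \<alpha> \<beta> \<zeta> z (real n) a b)"
  have C1: "C1_on_Rplus W" unfolding W_def by (rule C1_gamma_weight[OF assms(1) ab \<alpha>\<beta>])
  have kk: "kk_term k a b \<alpha> \<beta> \<zeta> z n = W (real n) * G n" for n
    unfolding W_def G_def by (rule kk_term_eq_weight(1)) (fact ab \<alpha>\<beta> k)+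
  have Wk: "norm (W (real n)) * Gamma_bold 0 \<alpha> \<beta> (real n) a b = norm (k n)" for n
    unfolding W_def by (rule kk_term_eq_weight(2)) (fact ab \<alpha>\<beta> k)+
  obtain K where K: "K \<ge> 0"
    and int_h: "\<And>n. set_integrable lborel {real n..} h"
    and val_h: "\<And>n. (LINT s:{real n..}|lborel. h s) = - G n"
    and G_le: "\<And>n. norm (G n) \<le> K * Gamma_bold 0 \<alpha> \<beta> (real n) a b"
    and h_le: "\<And>n. (LINT s:{real n..}|lborel. norm (h s)) \<le> K * Gamma_bold 0 \<alpha> \<beta> (real n) a b"
    using kk_kernel_tail[OF ab \<alpha>\<beta> summable_norm_of_R_region(2)[OF assms(7)]]
    unfolding h_def G_def by (metis of_nat_0_le_iff)
  \<comment> \<open>The terms of the series and the tail integrals of the kernel are both at most a multiple of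
    \<open>\<Gamma>\<^sub>0\<close>, so one estimate gives the majorant \<open>K \<bar>\<kappa>\<^sub>n\<bar>\<close> for the two sums.\<close>
  have bound: "norm (W (real n)) * y \<le> K * norm (k n)" if "y \<le> K * Gamma_bold 0 \<alpha> \<beta> (real n) a b" for n y
  proof -
    have "norm (W (real n)) * y \<le> norm (W (real n)) * (K * Gamma_bold 0 \<alpha> \<beta> (real n) a b)"
      using that by (intro mult_left_mono) auto
    also have "\<dots> = K * norm (k n)" by (simp add: Wk[symmetric])
    finally show ?thesis .
  qed
  have summable_kk: "summable (kk_term k a b \<alpha> \<beta> \<zeta> z)"
  proof (rule summable_comparison_test[OF _ summable_mult[OF k_sum, of K]], intro exI allI impI)
    fix n
    show "norm (kk_term k a b \<alpha> \<beta> \<zeta> z n) \<le> K * norm (k n)"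
      unfolding kk norm_mult by (rule bound[OF G_le])
  qed
  have summable_tails: "summable (\<lambda>n. norm (W (real (Suc n))) * (LINT s:{real (Suc n)..}|lborel. norm (h s)))"
  proof (rule summable_comparison_test, intro exI allI impI)
    show "summable (\<lambda>n. K * norm (k (Suc n)))"
      using k_sum summable_Suc_iff[of "\<lambda>n. norm (k n)"] by (intro summable_mult) blast
    fix n
    have "0 \<le> (LINT s:{real (Suc n)..}|lborel. norm (h s))"
      unfolding set_lebesgue_integral_def by (intro integral_nonneg_AE) auto
    thus "norm (norm (W (real (Suc n))) * (LINT s:{real (Suc n)..}|lborel. norm (h s))) \<le> K * norm (k (Suc n))"
      using bound[OF h_le, of "Suc n"] by (simp add: abs_mult)
  qed
  note ps = partial_summation_integral[of h "\<lambda>n. W (real n)", OF int_h summable_tails]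
  have floor_nat: "real_of_int \<lfloor>s\<rfloor> = real (nat \<lfloor>s\<rfloor>)" if "s > 0" for s :: real
    using that by simp
  have inner: "set_integrable lborel {0..real_of_int \<lfloor>s\<rfloor>} (\<lambda>u. kk_integrand \<kappa> a b \<alpha> \<beta> \<zeta> z s u)"
    "(LINT u:{0..real_of_int \<lfloor>s\<rfloor>}|lborel. kk_integrand \<kappa> a b \<alpha> \<beta> \<zeta> z s u)
       = (\<Sum>i<nat \<lfloor>s\<rfloor>. W (real (Suc i))) * h s" if "s > 0" for s
    using dfrak_integral_eq_sum[OF C1, of "nat \<lfloor>s\<rfloor>"]
    unfolding kk_integrand_def W_def[symmetric] h_def[symmetric] floor_nat[OF that]
    by (auto intro: set_integrable_mult_left)
  have outer: "set_integrable lborel {0<..}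
        (\<lambda>s. LINT u:{0..real_of_int \<lfloor>s\<rfloor>}|lborel. kk_integrand \<kappa> a b \<alpha> \<beta> \<zeta> z s u)"
    using ps(1) by (subst set_integrable_cong[OF refl refl inner(2)]) auto
  have outer_val: "(LINT s:{0<..}|lborel. LINT u:{0..real_of_int \<lfloor>s\<rfloor>}|lborel. kk_integrand \<kappa> a b \<alpha> \<beta> \<zeta> z s u)
      = (LINT s:{0<..}|lborel. (\<Sum>i<nat \<lfloor>s\<rfloor>. W (real (Suc i))) * h s)"
    using inner(2) by (intro set_lebesgue_integral_cong) auto
  have "(\<lambda>n. - kk_term k a b \<alpha> \<beta> \<zeta> z (Suc n)) sums
      (LINT s:{0<..}|lborel. (\<Sum>i<nat \<lfloor>s\<rfloor>. W (real (Suc i))) * h s)"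
    using ps(2) unfolding val_h kk by simp
  hence "(\<Sum>n. kk_term k a b \<alpha> \<beta> \<zeta> z (Suc n)) =
      - (LINT s:{0<..}|lborel. (\<Sum>i<nat \<lfloor>s\<rfloor>. W (real (Suc i))) * h s)"
    using sums_minus sums_unique by fastforce
  moreover have "kapteyn_kummer k a b \<alpha> \<beta> \<zeta> z = kk_term k a b \<alpha> \<beta> \<zeta> z 0 + (\<Sum>n. kk_term k a b \<alpha> \<beta> \<zeta> z (Suc n))"
    unfolding kapteyn_kummer_def using suminf_split_head[OF summable_kk] by simp
  moreover have "kk_term k a b \<alpha> \<beta> \<zeta> z 0 = k 0 * kummer_M (of_real a) (of_real b) z"
    by (simp add: kk_term_def)
  ultimately have main: "kapteyn_kummer k a b \<alpha> \<beta> \<zeta> z =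
        k 0 * kummer_M (of_real a) (of_real b) z
        - (LINT s:{0<..}|lborel. LINT u:{0..real_of_int \<lfloor>s\<rfloor>}|lborel.
             kk_integrand \<kappa> a b \<alpha> \<beta> \<zeta> z s u)"
    by (simp add: outer_val)
  have pos: "a + \<alpha> * s > 0" "b + \<beta> * s > 0" if "s \<ge> 0" for s
    using that ab \<alpha>\<beta> by (auto intro!: add_pos_nonneg)
  show ?thesis
    by (intro conjI allI impI summable_kk inner(1) outer main M_star_derivative_a M_star_derivative_b pos)
qed

end
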